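(* Let $\mathbf{C}$ be a quasitopos, let $\mathcal{M}$ be its class of regular monomorphisms, and require in every rewriting formalism below that match morphisms are regular monomorphisms. Then $$\mathrm{SqPO} \prec_{\mathbf{C}} \mathrm{AGREE} \prec_{\mathbf{C}} \mathrm{PBPO}^{+},\qquad \mathrm{DPO} \prec_{\mathbf{C}} \mathrm{PBPO}^{+},\qquad \mathrm{PBPO} \prec_{\mathbf{C}} \mathrm{PBPO}^{+}.$$
   Context: A quasitopos is a category with all finite limits and colimits that is locally cartesian closed and has a regular-subobject classifier. In a quasitopos the regular monos form a stable system of monics $\mathcal{M}$ (monos containing all isos, closed under composition, stable under pullback), and there is an $\mathcal{M}$-partial map classifier $(T,\eta)$: a functor $T:\mathbf{C}\to\mathbf{C}$ and a natural transformation $\eta:\mathrm{Id}\to T$ with every $\eta_X\in\mathcal{M}$, such that for every span $A \xleftarrow{m} X \xrightarrow{f} B$ with $m\in\mathcal{M}$ there is a unique $[m,f]:A\to T(B)$ making the square $\eta_B\circ f=[m,f]\circ m$ a pullback. For rewriting formalisms $\mathcal{F},\mathcal{G}$, write $\mathcal{F}\prec_{\mathbf{C}}\mathcal{G}$ if for every $\mathcal{F}$-rule $\rho$ there is a $\mathcal{G}$-rule $\tau$ with $\Rightarrow^{\rho}_{\mathcal{F}} = \Rightarrow^{\tau}_{\mathcal{G}}$, where $G\Rightarrow^{\rho}_{\mathcal{F}} H$ means there is some (admissible) match giving a step from $G$ to $H$. PBPO$^+$: a rule consists of $l:K\to L$, $r:K\to R$, $t_L:L\to L'$, $t_K:K\to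 K'$, $l':K'\to L'$ with $t_L\circ l=l'\circ t_K$ a pullback. A step from $G_L$ to $G_R$ with match $m:L\to G_L$ and adherence $\alpha:G_L\to L'$ holds if $\alpha\circ m=t_L$ and $L\xleftarrow{1_L}L\xrightarrow{m}G_L$ is a pullback of $L\xrightarrow{t_L}L'\xleftarrow{\alpha}G_L$; $G_L\xleftarrow{g_L}G_K\xrightarrow{u'}K'$ is a pullback of $G_L\xrightarrow{\alpha}L'\xleftarrow{l'}K'$; $u:K\to G_K$ is the unique morphism with $u'\circ u=t_K$; and $G_K\xrightarrow{g_R}G_R\xleftarrow{w}R$ is a pushout of $G_K\xleftarrow{u}K\xrightarrow{r}R$. PBPO: a rule is a commutative diagram of spans $L\xleftarrow{l}K\xrightarrow{r}R$ over $L'\xleftarrow{l'}K'\xrightarrow{r'}R'$ with vertical $t_L,t_K,t_R$ ($t_L l=l't_K$, $t_R r=r't_K$). A step with $m:L\to G_L$, $\alpha:G_L\to L'$ holds if $t_L=\alpha\circ m$, $G_L\xleftarrow{g_L}G_K\xrightarrow{u'}K'$ is a pullback of $\alpha,l'$, $u:K\to G_K$ is the morphism induced by this pullback with $g_L u=m l$, $u'u=t_K$, and $G_R$ is the pushout of $G_K\xleftarrow{u}K\xrightarrow{r}R$. AGREE: a rule is a span $L\xleftarrow{l}K\xrightarrow{r}R$ with $t_K:K\to K'$ in $\mathcal{M}$. A step with match $m:L\to G_L$ in $\mathcal{M}$: $G_L\xleftarrow{g_L}G_K\to K'$ is a pullback of $G_L\xrightarrow{[m,1_L]}T(L)\xleftarrow{[t_K,l]}K'$,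 $u:K\to G_K$ is induced, and $G_R$ is the pushout of $u$ and $r$. DPO: a rule is a span $L\xleftarrow{l}K\xrightarrow{r}R$ with $l\in\mathcal{M}$; a step with match $m$ is a diagram $L\xleftarrow{l}K\xrightarrow{r}R$ over $G_L\leftarrow G_K\to G_R$ in which both squares are pushouts. SqPO: a rule is a span $L\xleftarrow{l}K\xrightarrow{r}R$; a step with match $m:L\to G_L$ consists of $u:K\to G_K$, $g_L:G_K\to G_L$ forming a final pullback complement of $(l,m)$ and a pushout $G_R$ of $G_K\xleftarrow{u}K\xrightarrow{r}R$. Here $(u,g_L)$ is a final pullback complement of $(l,m)$ if $g_L\circ u=m\circ l$ is a pullback and for every pullback square $m\circ a'=d'\circ c'$ (with $a':X\to L$, $c':X\to C'$, $d':C'\to G_L$) and every $f:X\to K$ with $l\circ f=a'$, there is a unique $g:C'\to G_K$ with $g_L\circ g=d'$ and $g\circ c'=u\circ f$. *)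

theory Defs
  imports Main
begin

section \<open>Categories\<close>

record ('o, 'a) cat =
  Ob :: "'o set"
  Ar :: "'a set"
  Dom :: "'a \<Rightarrow> 'o"
  Cod :: "'a \<Rightarrow> 'o"
  Ident :: "'o \<Rightarrow> 'a"
  Comp :: "'a \<Rightarrow> 'a \<Rightarrow> 'a"  (infixr "\<cdot>\<index>" 70)

definition hom :: "('o, 'a) cat \<Rightarrow> 'o \<Rightarrow> 'o \<Rightarrow> 'a set" where
  "hom C A B = {f \<in> Ar C. Dom C f = A \<and> Cod C f = B}"

locale category =
  fixes C :: "('o, 'a) cat" (structure)
  assumes dom_in_Ob: "f \<in> Ar C \<Longrightarrow> Dom C f \<in> Ob C"
    and cod_in_Ob: "f \<in> Ar C \<Longrightarrow> Cod C f \<in> Ob C"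
    and ident_in_hom: "A \<in> Ob C \<Longrightarrow> Ident C A \<in> hom C A A"
    and comp_in_hom: "f \<in> hom C A B \<Longrightarrow> g \<in> hom C B D \<Longrightarrow> g \<cdot> f \<in> hom C A D"
    and comp_ident_left: "f \<in> hom C A B \<Longrightarrow> Ident C B \<cdot> f = f"
    and comp_ident_right: "f \<in> hom C A B \<Longrightarrow> f \<cdot> Ident C A = f"
    and comp_assoc: "f \<in> hom C A B \<Longrightarrow> g \<in> hom C B D \<Longrightarrow> h \<in> hom C D E \<Longrightarrow>
      (h \<cdot> g) \<cdot> f = h \<cdot> (g \<cdot> f)"

definition is_functor ::
    "('i, 'j) cat \<Rightarrow> ('o, 'a) cat \<Rightarrow> ('i \<Rightarrow> 'o) \<Rightarrow> ('j \<Rightarrow> 'a) \<Rightarrow> bool" where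
  "is_functor J C F Fm \<longleftrightarrow>
     category J \<and> category C \<and>
     (\<forall>i\<in>Ob J. F i \<in> Ob C) \<and>
     (\<forall>u\<in>Ar J. Fm u \<in> hom C (F (Dom J u)) (F (Cod J u))) \<and>
     (\<forall>i\<in>Ob J. Fm (Ident J i) = Ident C (F i)) \<and>
     (\<forall>u\<in>Ar J. \<forall>v\<in>Ar J. Cod J u = Dom J v \<longrightarrow>
        Fm (v \<cdot>\<^bsub>J\<^esub> u) = Fm v \<cdot>\<^bsub>C\<^esub> Fm u)"


section \<open>Limits and colimits\<close>

definition is_cone ::
    "('i, 'j) cat \<Rightarrow> ('o, 'a) cat \<Rightarrow> ('i \<Rightarrow> 'o) \<Rightarrow> ('j \<Rightarrow> 'a) \<Rightarrow> 'o \<Rightarrow> ('i \<Rightarrow> 'a) \<Rightarrow> bool" where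
  "is_cone J C F Fm X p \<longleftrightarrow>
     X \<in> Ob C \<and> (\<forall>i\<in>Ob J. p i \<in> hom C X (F i)) \<and>
     (\<forall>u\<in>Ar J. Fm u \<cdot>\<^bsub>C\<^esub> p (Dom J u) = p (Cod J u))"

definition is_limit ::
    "('i, 'j) cat \<Rightarrow> ('o, 'a) cat \<Rightarrow> ('i \<Rightarrow> 'o) \<Rightarrow> ('j \<Rightarrow> 'a) \<Rightarrow> 'o \<Rightarrow> ('i \<Rightarrow> 'a) \<Rightarrow> bool" where
  "is_limit J C F Fm X p \<longleftrightarrow>
     is_cone J C F Fm X p \<and>
     (\<forall>Y q. is_cone J C F Fm Y q \<longrightarrow>
        (\<exists>!h. h \<in> hom C Y X \<and> (\<forall>i\<in>Ob J. p i \<cdot>\<^bsub>C\<^esub> h = q i)))"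

definition is_cocone ::
    "('i, 'j) cat \<Rightarrow> ('o, 'a) cat \<Rightarrow> ('i \<Rightarrow> 'o) \<Rightarrow> ('j \<Rightarrow> 'a) \<Rightarrow> 'o \<Rightarrow> ('i \<Rightarrow> 'a) \<Rightarrow> bool" where
  "is_cocone J C F Fm X p \<longleftrightarrow>
     X \<in> Ob C \<and> (\<forall>i\<in>Ob J. p i \<in> hom C (F i) X) \<and>
     (\<forall>u\<in>Ar J. p (Cod J u) \<cdot>\<^bsub>C\<^esub> Fm u = p (Dom J u))"

definition is_colimit ::
    "('i, 'j) cat \<Rightarrow> ('o, 'a) cat \<Rightarrow> ('i \<Rightarrow> 'o) \<Rightarrow> ('j \<Rightarrow> 'a) \<Rightarrow> 'o \<Rightarrow> ('i \<Rightarrow> 'a) \<Rightarrow> bool" where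
  "is_colimit J C F Fm X p \<longleftrightarrow>
     is_cocone J C F Fm X p \<and>
     (\<forall>Y q. is_cocone J C F Fm Y q \<longrightarrow>
        (\<exists>!h. h \<in> hom C X Y \<and> (\<forall>i\<in>Ob J. h \<cdot>\<^bsub>C\<^esub> p i = q i)))"

definition finite_category :: "('i, 'j) cat \<Rightarrow> bool" where
  "finite_category J \<longleftrightarrow> category J \<and> finite (Ob J) \<and> finite (Ar J)"

text \<open>
  Every finite category is isomorphic to one whose objects and arrows are natural numbers,
  so it is enough to let finite index categories range over this type.
\<close>

definition has_finite_limits :: "('o, 'a) cat \<Rightarrow> bool" where
  "has_finite_limits C \<longleftrightarrow>
     (\<forall>(J :: (nat, nat) cat) F Fm. finite_category J \<and> is_functor J C F Fm \<longrightarrow>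
        (\<exists>X p. is_limit J C F Fm X p))"

definition has_finite_colimits :: "('o, 'a) cat \<Rightarrow> bool" where
  "has_finite_colimits C \<longleftrightarrow>
     (\<forall>(J :: (nat, nat) cat) F Fm. finite_category J \<and> is_functor J C F Fm \<longrightarrow>
        (\<exists>X p. is_colimit J C F Fm X p))"

context
  fixes C :: "('o, 'a) cat" (structure)
begin

definition is_terminal :: "'o \<Rightarrow> bool" where
  "is_terminal X \<longleftrightarrow> X \<in> Ob C \<and> (\<forall>Y\<in>Ob C. \<exists>!h. h \<in> hom C Y X)"

definition is_product :: "'o \<Rightarrow> 'o \<Rightarrow> 'o \<Rightarrow> 'a \<Rightarrow> 'a \<Rightarrow> bool" where
  "is_product A B P p q \<longleftrightarrow>
     p \<in> hom C P A \<and> q \<in> hom C P B \<and>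
     (\<forall>Z a b. a \<in> hom C Z A \<and> b \<in> hom C Z B \<longrightarrow>
        (\<exists>!h. h \<in> hom C Z P \<and> p \<cdot> h = a \<and> q \<cdot> h = b))"

text \<open>The square \<open>f \<cdot> p = g \<cdot> q\<close> is a pullback of the cospan \<open>(f, g)\<close>.\<close>

definition is_pullback :: "'a \<Rightarrow> 'a \<Rightarrow> 'a \<Rightarrow> 'a \<Rightarrow> bool" where
  "is_pullback f g p q \<longleftrightarrow>
     f \<in> Ar C \<and> g \<in> Ar C \<and> Cod C f = Cod C g \<and>
     p \<in> hom C (Dom C p) (Dom C f) \<and> q \<in> hom C (Dom C p) (Dom C g) \<and>
     f \<cdot> p = g \<cdot> q \<and>
     (\<forall>Z a b. a \<in> hom C Z (Dom C f) \<and> b \<in> hom C Z (Dom C g) \<and> f \<cdot> a = g \<cdot> b \<longrightarrow>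
        (\<exists>!h. h \<in> hom C Z (Dom C p) \<and> p \<cdot> h = a \<and> q \<cdot> h = b))"

text \<open>The square \<open>i \<cdot> f = j \<cdot> g\<close> is a pushout of the span \<open>(f, g)\<close>.\<close>

definition is_pushout :: "'a \<Rightarrow> 'a \<Rightarrow> 'a \<Rightarrow> 'a \<Rightarrow> bool" where
  "is_pushout f g i j \<longleftrightarrow>
     f \<in> Ar C \<and> g \<in> Ar C \<and> Dom C f = Dom C g \<and>
     i \<in> hom C (Cod C f) (Cod C i) \<and> j \<in> hom C (Cod C g) (Cod C i) \<and>
     i \<cdot> f = j \<cdot> g \<and>
     (\<forall>Z a b. a \<in> hom C (Cod C f) Z \<and> b \<in> hom C (Cod C g) Z \<and> a \<cdot> f = b \<cdot> g \<longrightarrow>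
        (\<exists>!h. h \<in> hom C (Cod C i) Z \<and> h \<cdot> i = a \<and> h \<cdot> j = b))"

definition is_equalizer :: "'a \<Rightarrow> 'a \<Rightarrow> 'a \<Rightarrow> bool" where
  "is_equalizer f g e \<longleftrightarrow>
     f \<in> Ar C \<and> g \<in> hom C (Dom C f) (Cod C f) \<and>
     e \<in> hom C (Dom C e) (Dom C f) \<and> f \<cdot> e = g \<cdot> e \<and>
     (\<forall>Z a. a \<in> hom C Z (Dom C f) \<and> f \<cdot> a = g \<cdot> a \<longrightarrow>
        (\<exists>!h. h \<in> hom C Z (Dom C e) \<and> e \<cdot> h = a))"

definition regular_monos :: "'a set" where
  "regular_monos = {m. \<exists>f g. is_equalizer f g m}"


section \<open>Quasitoposes\<close>

text \<open>
  \<open>E\<close> is the exponential of \<open>B\<close> by \<open>A\<close>, with evaluation \<open>ev : E \<times> A \<rightarrow> B\<close>, where \<open>(P, p, q)\<close>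
  is the product of \<open>E\<close> and \<open>A\<close>. In the universal property, \<open>h\<close> is the arrow \<open>g \<times> A\<close>.
\<close>

definition is_exponential :: "'o \<Rightarrow> 'o \<Rightarrow> 'o \<Rightarrow> 'o \<Rightarrow> 'a \<Rightarrow> 'a \<Rightarrow> 'a \<Rightarrow> bool" where
  "is_exponential A B E P p q ev \<longleftrightarrow>
     is_product E A P p q \<and> ev \<in> hom C P B \<and>
     (\<forall>Z Q s t f. is_product Z A Q s t \<and> f \<in> hom C Q B \<longrightarrow>
        (\<exists>!g. g \<in> hom C Z E \<and>
           (\<exists>h\<in>hom C Q P. p \<cdot> h = g \<cdot> s \<and> q \<cdot> h = t \<and> ev \<cdot> h = f)))"

definition cartesian_closed :: bool where
  "cartesian_closed \<longleftrightarrow>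
     category C \<and>
     (\<exists>X. is_terminal X) \<and>
     (\<forall>A\<in>Ob C. \<forall>B\<in>Ob C. \<exists>P p q. is_product A B P p q) \<and>
     (\<forall>A\<in>Ob C. \<forall>B\<in>Ob C. \<exists>E P p q ev. is_exponential A B E P p q ev)"

text \<open>An arrow of the slice over \<open>X\<close> is a triple \<open>(f, h, g)\<close> with \<open>h : f \<rightarrow> g\<close> over \<open>X\<close>.\<close>

definition slice :: "'o \<Rightarrow> ('a, 'a \<times> 'a \<times> 'a) cat" where
  "slice X =
     \<lparr>Ob = {f \<in> Ar C. Cod C f = X},
      Ar = {(f, h, g). f \<in> Ar C \<and> Cod C f = X \<and> g \<in> Ar C \<and> Cod C g = X \<and>
                       h \<in> hom C (Dom C f) (Dom C g) \<and> g \<cdot> h = f},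
      Dom = (\<lambda>(f, h, g). f),
      Cod = (\<lambda>(f, h, g). g),
      Ident = (\<lambda>f. (f, Ident C (Dom C f), f)),
      Comp = (\<lambda>(f', h', g') (f, h, g). (f, h' \<cdot> h, g'))\<rparr>"

definition is_regular_subobject_classifier :: "'o \<Rightarrow> 'o \<Rightarrow> 'a \<Rightarrow> bool" where
  "is_regular_subobject_classifier one \<Omega> true \<longleftrightarrow>
     is_terminal one \<and> true \<in> hom C one \<Omega> \<and>
     (\<forall>m\<in>regular_monos. \<exists>!\<chi>. \<chi> \<in> hom C (Cod C m) \<Omega> \<and>
        (\<exists>b\<in>hom C (Dom C m) one. is_pullback \<chi> true m b))"

end

definition locally_cartesian_closed :: "('o, 'a) cat \<Rightarrow> bool" where
  "locally_cartesian_closed C \<longleftrightarrow> (\<forall>X\<in>Ob C. cartesian_closed (slice C X))"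

locale quasitopos = category C for C :: "('o, 'a) cat" (structure) +
  assumes finite_limits: "has_finite_limits C"
    and finite_colimits: "has_finite_colimits C"
    and locally_cartesian_closed: "locally_cartesian_closed C"
    and regular_subobject_classifier:
      "\<exists>one \<Omega> true. is_regular_subobject_classifier C one \<Omega> true"


section \<open>Partial map classifiers and final pullback complements\<close>

context
  fixes C :: "('o, 'a) cat" (structure)
begin

text \<open>\<open>T\<close> and \<open>Tm\<close> are the object and arrow parts of the functor.\<close>

definition is_partial_map_classifier ::
    "'a set \<Rightarrow> ('o \<Rightarrow> 'o) \<Rightarrow> ('a \<Rightarrow> 'a) \<Rightarrow> ('o \<Rightarrow> 'a) \<Rightarrow> bool" where
  "is_partial_map_classifier M T Tm \<eta> \<longleftrightarrow>
     is_functor C C T Tm \<and>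
     (\<forall>X\<in>Ob C. \<eta> X \<in> hom C X (T X) \<and> \<eta> X \<in> M) \<and>
     (\<forall>f\<in>Ar C. Tm f \<cdot> \<eta> (Dom C f) = \<eta> (Cod C f) \<cdot> f) \<and>
     (\<forall>m\<in>M. \<forall>f\<in>Ar C. Dom C m = Dom C f \<longrightarrow>
        (\<exists>!h. h \<in> hom C (Cod C m) (T (Cod C f)) \<and> is_pullback C h (\<eta> (Cod C f)) m f))"

definition classify :: "('o \<Rightarrow> 'o) \<Rightarrow> ('o \<Rightarrow> 'a) \<Rightarrow> 'a \<Rightarrow> 'a \<Rightarrow> 'a" where
  "classify T \<eta> m f =
     (THE h. h \<in> hom C (Cod C m) (T (Cod C f)) \<and> is_pullback C h (\<eta> (Cod C f)) m f)"

text \<open>\<open>(u, g\<^sub>L)\<close> is a final pullback complement of \<open>(l, m)\<close>.\<close>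

definition is_final_pullback_complement :: "'a \<Rightarrow> 'a \<Rightarrow> 'a \<Rightarrow> 'a \<Rightarrow> bool" where
  "is_final_pullback_complement l m u g\<^sub>L \<longleftrightarrow>
     is_pullback C g\<^sub>L m u l \<and>
     (\<forall>a c d f. is_pullback C m d a c \<and> f \<in> hom C (Dom C a) (Dom C l) \<and> l \<cdot> f = a \<longrightarrow>
        (\<exists>!g. g \<in> hom C (Dom C d) (Dom C g\<^sub>L) \<and> g\<^sub>L \<cdot> g = d \<and> g \<cdot> c = u \<cdot> f))"

end


section \<open>Rewriting formalisms\<close>

record ('r, 'o) formalism =
  rules :: "'r set"
  rewrites_to :: "'r \<Rightarrow> 'o \<Rightarrow> 'o \<Rightarrow> bool"

definition modeled_by :: "('r, 'o) formalism \<Rightarrow> ('s, 'o) formalism \<Rightarrow> bool"  (infix "\<prec>" 50) where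
  "F \<prec> G \<longleftrightarrow> (\<forall>\<rho>\<in>rules F. \<exists>\<tau>\<in>rules G. rewrites_to F \<rho> = rewrites_to G \<tau>)"

text \<open>The arrows are \<open>l, r\<close>.\<close>

datatype 'a span_rule = Span_Rule 'a 'a

text \<open>The arrows are \<open>l, r, t\<^sub>K\<close>.\<close>

datatype 'a agree_rule = AGREE_Rule 'a 'a 'a

text \<open>The arrows are \<open>l, r, t\<^sub>L, t\<^sub>K, l'\<close>.\<close>

datatype 'a pbpo_plus_rule = PBPO_Plus_Rule 'a 'a 'a 'a 'a

text \<open>The arrows are \<open>l, r, t\<^sub>L, t\<^sub>K, t\<^sub>R, l', r'\<close>.\<close>

datatype 'a pbpo_rule = PBPO_Rule 'a 'a 'a 'a 'a 'a 'a

context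
  fixes C :: "('o, 'a) cat" (structure)
begin

fun is_span_rule :: "'a span_rule \<Rightarrow> bool" where
  "is_span_rule (Span_Rule l r) \<longleftrightarrow> (\<exists>K L R. l \<in> hom C K L \<and> r \<in> hom C K R)"

fun is_dpo_rule :: "'a set \<Rightarrow> 'a span_rule \<Rightarrow> bool" where
  "is_dpo_rule M (Span_Rule l r) \<longleftrightarrow> is_span_rule (Span_Rule l r) \<and> l \<in> M"

fun is_agree_rule :: "'a set \<Rightarrow> 'a agree_rule \<Rightarrow> bool" where
  "is_agree_rule M (AGREE_Rule l r t\<^sub>K) \<longleftrightarrow>
     (\<exists>K L R K'. l \<in> hom C K L \<and> r \<in> hom C K R \<and> t\<^sub>K \<in> hom C K K' \<and> t\<^sub>K \<in> M)"

fun is_pbpo_plus_rule :: "'a pbpo_plus_rule \<Rightarrow> bool" where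
  "is_pbpo_plus_rule (PBPO_Plus_Rule l r t\<^sub>L t\<^sub>K l') \<longleftrightarrow>
     (\<exists>K L R K' L'. l \<in> hom C K L \<and> r \<in> hom C K R \<and> t\<^sub>L \<in> hom C L L' \<and>
        t\<^sub>K \<in> hom C K K' \<and> l' \<in> hom C K' L' \<and> is_pullback C t\<^sub>L l' l t\<^sub>K)"

fun is_pbpo_rule :: "'a pbpo_rule \<Rightarrow> bool" where
  "is_pbpo_rule (PBPO_Rule l r t\<^sub>L t\<^sub>K t\<^sub>R l' r') \<longleftrightarrow>
     (\<exists>K L R K' L' R'. l \<in> hom C K L \<and> r \<in> hom C K R \<and>
        t\<^sub>L \<in> hom C L L' \<and> t\<^sub>K \<in> hom C K K' \<and> t\<^sub>R \<in> hom C R R' \<and>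
        l' \<in> hom C K' L' \<and> r' \<in> hom C K' R' \<and>
        t\<^sub>L \<cdot> l = l' \<cdot> t\<^sub>K \<and> t\<^sub>R \<cdot> r = r' \<cdot> t\<^sub>K)"

fun dpo_step :: "'a span_rule \<Rightarrow> 'a \<Rightarrow> 'o \<Rightarrow> 'o \<Rightarrow> bool" where
  "dpo_step (Span_Rule l r) m G\<^sub>L G\<^sub>R \<longleftrightarrow>
     m \<in> hom C (Cod C l) G\<^sub>L \<and>
     (\<exists>G\<^sub>K u g\<^sub>L g\<^sub>R w.
        u \<in> hom C (Dom C l) G\<^sub>K \<and> g\<^sub>L \<in> hom C G\<^sub>K G\<^sub>L \<and> g\<^sub>R \<in> hom C G\<^sub>K G\<^sub>R \<and>
        is_pushout C u l g\<^sub>L m \<and>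
        is_pushout C u r g\<^sub>R w)"

fun sqpo_step :: "'a span_rule \<Rightarrow> 'a \<Rightarrow> 'o \<Rightarrow> 'o \<Rightarrow> bool" where
  "sqpo_step (Span_Rule l r) m G\<^sub>L G\<^sub>R \<longleftrightarrow>
     m \<in> hom C (Cod C l) G\<^sub>L \<and>
     (\<exists>G\<^sub>K u g\<^sub>L g\<^sub>R w.
        u \<in> hom C (Dom C l) G\<^sub>K \<and> g\<^sub>L \<in> hom C G\<^sub>K G\<^sub>L \<and> g\<^sub>R \<in> hom C G\<^sub>K G\<^sub>R \<and>
        is_final_pullback_complement C l m u g\<^sub>L \<and>
        is_pushout C u r g\<^sub>R w)"

fun agree_step ::
    "('o \<Rightarrow> 'o) \<Rightarrow> ('o \<Rightarrow> 'a) \<Rightarrow> 'a agree_rule \<Rightarrow> 'a \<Rightarrow> 'o \<Rightarrow> 'o \<Rightarrow> bool" where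
  "agree_step T \<eta> (AGREE_Rule l r t\<^sub>K) m G\<^sub>L G\<^sub>R \<longleftrightarrow>
     m \<in> hom C (Cod C l) G\<^sub>L \<and>
     (\<exists>G\<^sub>K u g\<^sub>L u' g\<^sub>R w.
        u \<in> hom C (Dom C l) G\<^sub>K \<and> g\<^sub>L \<in> hom C G\<^sub>K G\<^sub>L \<and> g\<^sub>R \<in> hom C G\<^sub>K G\<^sub>R \<and>
        is_pullback C (classify C T \<eta> m (Ident C (Cod C l))) (classify C T \<eta> t\<^sub>K l) g\<^sub>L u' \<and>
        g\<^sub>L \<cdot> u = m \<cdot> l \<and> u' \<cdot> u = t\<^sub>K \<and>
        is_pushout C u r g\<^sub>R w)"

fun pbpo_plus_step :: "'a pbpo_plus_rule \<Rightarrow> 'a \<Rightarrow> 'a \<Rightarrow> 'o \<Rightarrow> 'o \<Rightarrow> bool" where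
  "pbpo_plus_step (PBPO_Plus_Rule l r t\<^sub>L t\<^sub>K l') m \<alpha> G\<^sub>L G\<^sub>R \<longleftrightarrow>
     m \<in> hom C (Cod C l) G\<^sub>L \<and> \<alpha> \<in> hom C G\<^sub>L (Cod C t\<^sub>L) \<and> \<alpha> \<cdot> m = t\<^sub>L \<and>
     is_pullback C t\<^sub>L \<alpha> (Ident C (Cod C l)) m \<and>
     (\<exists>G\<^sub>K u g\<^sub>L u' g\<^sub>R w.
        u \<in> hom C (Dom C l) G\<^sub>K \<and> g\<^sub>L \<in> hom C G\<^sub>K G\<^sub>L \<and> g\<^sub>R \<in> hom C G\<^sub>K G\<^sub>R \<and>
        is_pullback C \<alpha> l' g\<^sub>L u' \<and>
        u' \<cdot> u = t\<^sub>K \<and> (\<forall>v\<in>hom C (Dom C l) G\<^sub>K. u' \<cdot> v = t\<^sub>K \<longrightarrow> v = u) \<and>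
        is_pushout C u r g\<^sub>R w)"

fun pbpo_step :: "'a pbpo_rule \<Rightarrow> 'a \<Rightarrow> 'a \<Rightarrow> 'o \<Rightarrow> 'o \<Rightarrow> bool" where
  "pbpo_step (PBPO_Rule l r t\<^sub>L t\<^sub>K t\<^sub>R l' r') m \<alpha> G\<^sub>L G\<^sub>R \<longleftrightarrow>
     m \<in> hom C (Cod C l) G\<^sub>L \<and> \<alpha> \<in> hom C G\<^sub>L (Cod C t\<^sub>L) \<and> \<alpha> \<cdot> m = t\<^sub>L \<and>
     (\<exists>G\<^sub>K u g\<^sub>L u' g\<^sub>R w.
        u \<in> hom C (Dom C l) G\<^sub>K \<and> g\<^sub>L \<in> hom C G\<^sub>K G\<^sub>L \<and> g\<^sub>R \<in> hom C G\<^sub>K G\<^sub>R \<and>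
        is_pullback C \<alpha> l' g\<^sub>L u' \<and>
        g\<^sub>L \<cdot> u = m \<cdot> l \<and> u' \<cdot> u = t\<^sub>K \<and>
        is_pushout C u r g\<^sub>R w)"

text \<open>
  In each formalism the matches are required to belong to \<open>M\<close>. In \<open>DPO\<close> and \<open>AGREE\<close>,
  \<open>M\<close> is also the class to which \<open>l\<close>, respectively \<open>t\<^sub>K\<close>, must belong.
\<close>

definition DPO :: "'a set \<Rightarrow> ('a span_rule, 'o) formalism" where
  "DPO M = \<lparr>rules = {\<rho>. is_dpo_rule M \<rho>},
            rewrites_to = (\<lambda>\<rho> G H. \<exists>m\<in>M. dpo_step \<rho> m G H)\<rparr>"

definition SqPO :: "'a set \<Rightarrow> ('a span_rule, 'o) formalism" where
  "SqPO M = \<lparr>rules = {\<rho>. is_span_rule \<rho>},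
             rewrites_to = (\<lambda>\<rho> G H. \<exists>m\<in>M. sqpo_step \<rho> m G H)\<rparr>"

definition AGREE ::
    "'a set \<Rightarrow> ('o \<Rightarrow> 'o) \<Rightarrow> ('o \<Rightarrow> 'a) \<Rightarrow> ('a agree_rule, 'o) formalism" where
  "AGREE M T \<eta> = \<lparr>rules = {\<rho>. is_agree_rule M \<rho>},
                  rewrites_to = (\<lambda>\<rho> G H. \<exists>m\<in>M. agree_step T \<eta> \<rho> m G H)\<rparr>"

definition PBPO_plus :: "'a set \<Rightarrow> ('a pbpo_plus_rule, 'o) formalism" where
  "PBPO_plus M = \<lparr>rules = {\<rho>. is_pbpo_plus_rule \<rho>},
                  rewrites_to = (\<lambda>\<rho> G H. \<exists>m\<in>M. \<exists>\<alpha>. pbpo_plus_step \<rho> m \<alpha> G H)\<rparr>"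

definition PBPO :: "'a set \<Rightarrow> ('a pbpo_rule, 'o) formalism" where
  "PBPO M = \<lparr>rules = {\<rho>. is_pbpo_rule \<rho>},
             rewrites_to = (\<lambda>\<rho> G H. \<exists>m\<in>M. \<exists>\<alpha>. pbpo_step \<rho> m \<alpha> G H)\<rparr>"

end

end

theory Submission
  imports Defs
begin

text \<open>
  Exponentials in the slices give, for every \<open>\<alpha> : G \<rightarrow> P\<close> and object \<open>Z\<close>, a partial product of \<open>\<alpha>\<close>
  and \<open>Z\<close>. For \<open>\<alpha> = true\<close> it is the object \<open>T Z\<close> classifying partial maps into \<open>Z\<close>; for general \<open>\<alpha>\<close> it
  shows that pushouts are stable under pullback. Mapping the pushout of a regular mono along
  \<open>f : K \<rightarrow> A\<close> to \<open>T A\<close> shows that it is also a pullback and that its coprojection from \<open>A\<close> is monic.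

  SqPO becomes AGREE with \<open>t\<^sub>K = \<eta> K\<close>, and AGREE becomes PBPO\<open>\<^sup>+\<close> with \<open>t\<^sub>L = \<eta> L\<close>, where the only
  adherence for a match \<open>m\<close> is \<open>[m, 1]\<close>. A DPO rule becomes the PBPO\<open>\<^sup>+\<close> rule whose type square is the
  pushout of \<open>l\<close> and \<open>\<eta> K\<close>: stability turns an adherence into a pushout complement, and conversely the
  adherence glued from \<open>t\<^sub>L\<close> and \<open>l' \<cdot> [u, 1]\<close> has the required pullbacks. In a PBPO rule \<open>L'\<close> is
  replaced by \<open>L' \<times> T L\<close>, so that an adherence also records the match.
\<close>

section \<open>Pullbacks, pushouts and regular monos\<close>

text \<open>A PBPO adherence may send parts of \<open>G\<close> outside the match onto the image of
  \<open>L\<close>, which PBPO+ forbids. The factor \<open>T L\<close> removes this conflict: the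
  pullback of \<open>\<eta> L\<close> along \<open>[m, 1]\<close> is exactly \<open>m\<close>, and
  \<open>[m, 1]\<close> exists because matches are regular monos. For DPO the type object glues
  \<open>T K\<close>, not a larger context, to \<open>L\<close>, so that the rest of
  \<open>G\<close> can touch the match only along \<open>K\<close>. Thus the gluing condition is
  built into the rule: an adherence for the match exists just when a pushout complement does.
  Stability rests on the fact that pulling back along \<open>\<alpha>\<close> has a right adjoint.
  Only its values at constant families are used: the universal property of a pushout concerns one
  target \<open>Z\<close> at a time, and a partial product represents arrows into that
  \<open>Z\<close>.\<close>

context category
begin

lemma comp_arr:
  assumes "f \<in> Ar C" "g \<in> Ar C" "Cod C f = Dom C g"
  shows "g \<cdot> f \<in> Ar C" "Dom C (g \<cdot> f) = Dom C f" "Cod C (g \<cdot> f) = Cod C g"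
  using assms comp_in_hom[of f "Dom C f" "Cod C f" g "Cod C g"] by (auto simp: hom_def)

lemma hom_objs:
  assumes "f \<in> hom C A B"
  shows "A \<in> Ob C" "B \<in> Ob C"
  using assms dom_in_Ob cod_in_Ob by (auto simp: hom_def)

lemma comp_assoc_arr:
  assumes "f \<in> Ar C" "g \<in> Ar C" "h \<in> Ar C" "Cod C f = Dom C g" "Cod C g = Dom C h"
  shows "(h \<cdot> g) \<cdot> f = h \<cdot> (g \<cdot> f)"
  using assms comp_assoc[of f _ _ g _ h] by (auto simp: hom_def)

lemmas cat_simps = hom_def comp_arr comp_assoc_arr

text \<open>Simplification nests composites to the right, so an equation
  \<open>g \<cdot> f = k\<close> does not match inside \<open>g \<cdot> (f \<cdot> x)\<close>. This
  form rewrites it there.\<close>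

lemma comp_extend:
  assumes "g \<cdot> f = k"
    and "f \<in> Ar C" "g \<in> Ar C" "Cod C f = Dom C g" "x \<in> Ar C" "Cod C x = Dom C f"
  shows "g \<cdot> (f \<cdot> x) = k \<cdot> x"
  using assms comp_assoc_arr[of x f g] by simp

lemma hom_unique:
  assumes "f \<in> hom C A B" "f \<in> hom C A' B'"
  shows "A = A'" "B = B'"
  using assms by (simp_all add: hom_def)

lemma comp_commute:
  assumes "f \<cdot> p = g \<cdot> q"
    and "p \<in> hom C P A" "f \<in> hom C A X" "q \<in> hom C P B" "g \<in> hom C B X" "h \<in> hom C Z P"
  shows "f \<cdot> (p \<cdot> h) = g \<cdot> (q \<cdot> h)"
  using comp_assoc[OF assms(6,2,3)] comp_assoc[OF assms(6,4,5)] assms(1) by simp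

lemma pullbackI:
  assumes "f \<in> hom C A X" "g \<in> hom C B X" "p \<in> hom C P A" "q \<in> hom C P B" "f \<cdot> p = g \<cdot> q"
    and "\<And>Z a b. a \<in> hom C Z A \<Longrightarrow> b \<in> hom C Z B \<Longrightarrow> f \<cdot> a = g \<cdot> b \<Longrightarrow>
      \<exists>h\<in>hom C Z P. p \<cdot> h = a \<and> q \<cdot> h = b"
    and "\<And>Z h h'. h \<in> hom C Z P \<Longrightarrow> h' \<in> hom C Z P \<Longrightarrow> p \<cdot> h = p \<cdot> h' \<Longrightarrow> q \<cdot> h = q \<cdot> h' \<Longrightarrow> h = h'"
  shows "is_pullback C f g p q"
proof -
  have eqs: "Dom C f = A" "Dom C g = B" "Dom C p = P" "Cod C f = X" "Cod C g = X" "f \<in> Ar C" "g \<in> Ar C"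
    using assms(1-4) by (auto simp: hom_def)
  have "\<exists>!h. h \<in> hom C Z P \<and> p \<cdot> h = a \<and> q \<cdot> h = b"
    if "a \<in> hom C Z A" "b \<in> hom C Z B" "f \<cdot> a = g \<cdot> b" for Z a b
    using assms(6)[OF that] assms(7) by (metis (no_types))
  with assms eqs show ?thesis unfolding is_pullback_def by auto
qed

lemma pullback_typing:
  assumes "is_pullback C f g p q"
  obtains A B X P where "f \<in> hom C A X" "g \<in> hom C B X" "p \<in> hom C P A" "q \<in> hom C P B"
  using assms unfolding is_pullback_def by (auto simp: hom_def)

lemma pullback_homs:
  assumes "is_pullback C f g p q" "f \<in> hom C A X" "q \<in> hom C P B"
  shows "g \<in> hom C B X" "p \<in> hom C P A"
  using assms by (simp_all add: is_pullback_def hom_def)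

lemma pullback_commutes: "is_pullback C f g p q \<Longrightarrow> f \<cdot> p = g \<cdot> q"
  unfolding is_pullback_def by blast

lemma pullback_lift:
  assumes "is_pullback C f g p q" "p \<in> hom C P A" "q \<in> hom C P B"
    and "a \<in> hom C Z A" "b \<in> hom C Z B" "f \<cdot> a = g \<cdot> b"
  obtains h where "h \<in> hom C Z P" "p \<cdot> h = a" "q \<cdot> h = b"
proof -
  have "A = Dom C f" "B = Dom C g" "P = Dom C p"
    using assms(1-3) by (auto simp: is_pullback_def hom_def)
  with assms that show thesis unfolding is_pullback_def by metis
qed

lemma pullback_eqI:
  assumes "is_pullback C f g p q" "p \<in> hom C P A"
    and "h \<in> hom C Z P" "h' \<in> hom C Z P" "p \<cdot> h = p \<cdot> h'" "q \<cdot> h = q \<cdot> h'"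
  shows "h = h'"
proof -
  obtain A' B X P' where t: "f \<in> hom C A' X" "g \<in> hom C B X" "p \<in> hom C P' A'" "q \<in> hom C P' B"
    using assms(1) by (rule pullback_typing)
  note t = t[unfolded hom_unique[OF t(3) assms(2)]]
  have "f \<cdot> (p \<cdot> h) = g \<cdot> (q \<cdot> h)"
    by (rule comp_commute[OF pullback_commutes[OF assms(1)] t(3,1,4,2) assms(3)])
  moreover have "p \<cdot> h \<in> hom C Z (Dom C f)" "q \<cdot> h \<in> hom C Z (Dom C g)"
    using t assms(3) comp_in_hom by (auto simp: hom_def)
  ultimately have "\<exists>!k. k \<in> hom C Z (Dom C p) \<and> p \<cdot> k = p \<cdot> h \<and> q \<cdot> k = q \<cdot> h"
    using assms(1) unfolding is_pullback_def by blast
  moreover have "Dom C p = P" using assms(2) by (simp add: hom_def)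
  ultimately show ?thesis using assms by metis
qed

lemma pullback_sym:
  assumes pb: "is_pullback C f g p q"
  shows "is_pullback C g f q p"
proof -
  obtain A B X P where t: "f \<in> hom C A X" "g \<in> hom C B X" "p \<in> hom C P A" "q \<in> hom C P B"
    using pb by (rule pullback_typing)
  show ?thesis
  proof (rule pullbackI[OF t(2,1,4,3) pullback_commutes[OF pb, symmetric]])
    fix Z a b assume "a \<in> hom C Z B" "b \<in> hom C Z A" "g \<cdot> a = f \<cdot> b"
    then show "\<exists>h\<in>hom C Z P. q \<cdot> h = a \<and> p \<cdot> h = b"
      using pullback_lift[OF pb t(3,4)] by metis
  qed (use pullback_eqI[OF pb t(3)] in blast)
qed

lemma pullback_paste:
  assumes 1: "is_pullback C f g p q" and 2: "is_pullback C a p s t"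
  shows "is_pullback C (f \<cdot> a) g s (q \<cdot> t)"
proof -
  obtain A B X P where t1: "f \<in> hom C A X" "g \<in> hom C B X" "p \<in> hom C P A" "q \<in> hom C P B"
    using 1 by (rule pullback_typing)
  obtain A' P' X' S where t2': "a \<in> hom C A' X'" "p \<in> hom C P' X'" "s \<in> hom C S A'" "t \<in> hom C S P'"
    using 2 by (rule pullback_typing)
  then have t2: "a \<in> hom C A' A" "s \<in> hom C S A'" "t \<in> hom C S P"
    using t1 by (auto simp: hom_def)
  note c1 = pullback_commutes[OF 1] and c2 = pullback_commutes[OF 2]
  show ?thesis
  proof (rule pullbackI)
    show "f \<cdot> a \<in> hom C A' X" "g \<in> hom C B X" "s \<in> hom C S A'" "q \<cdot> t \<in> hom C S B"
      using t1 t2 comp_in_hom by auto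
    show "(f \<cdot> a) \<cdot> s = g \<cdot> (q \<cdot> t)"
      using t1 t2 by (simp add: cat_simps c1 comp_extend[OF c1] c2)
  next
    fix Z x y assume x: "x \<in> hom C Z A'" and y: "y \<in> hom C Z B" and eq: "(f \<cdot> a) \<cdot> x = g \<cdot> y"
    have "f \<cdot> (a \<cdot> x) = g \<cdot> y" using eq t1 t2 x by (simp add: cat_simps)
    moreover have "a \<cdot> x \<in> hom C Z A" using t2 x comp_in_hom by blast
    ultimately obtain h where h: "h \<in> hom C Z P" "p \<cdot> h = a \<cdot> x" "q \<cdot> h = y"
      using pullback_lift[OF 1 t1(3,4)] y by metis
    then obtain k where k: "k \<in> hom C Z S" "s \<cdot> k = x" "t \<cdot> k = h"
      using pullback_lift[OF 2 t2(2,3)] x by metis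
    have "(q \<cdot> t) \<cdot> k = y" using comp_assoc[OF k(1) t2(3) t1(4)] k h by simp
    with k show "\<exists>h\<in>hom C Z S. s \<cdot> h = x \<and> (q \<cdot> t) \<cdot> h = y" by blast
  next
    fix Z h h' assume h: "h \<in> hom C Z S" "h' \<in> hom C Z S" and eq: "s \<cdot> h = s \<cdot> h'" "(q \<cdot> t) \<cdot> h = (q \<cdot> t) \<cdot> h'"
    have th: "t \<cdot> h \<in> hom C Z P" "t \<cdot> h' \<in> hom C Z P" using h t2 comp_in_hom by auto
    have "p \<cdot> (t \<cdot> h) = p \<cdot> (t \<cdot> h')"
      using h t1 t2 eq by (simp add: cat_simps c2[symmetric] comp_extend[OF c2[symmetric]])
    moreover have "q \<cdot> (t \<cdot> h) = q \<cdot> (t \<cdot> h')"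
      using h t1 t2 eq by (simp add: cat_simps)
    ultimately have "t \<cdot> h = t \<cdot> h'" using pullback_eqI[OF 1 t1(3) th] by blast
    then show "h = h'" using pullback_eqI[OF 2 t2(2) h] eq by blast
  qed
qed

lemma pullback_cancel:
  assumes 1: "is_pullback C f g p q" and 2: "is_pullback C (f \<cdot> a) g s (q \<cdot> t)"
    and a: "a \<in> hom C A' A" "f \<in> hom C A X" and t: "t \<in> hom C S P" "q \<in> hom C P B" and eq: "a \<cdot> s = p \<cdot> t"
  shows "is_pullback C a p s t"
proof -
  note t1 = a(2) pullback_homs[OF 1 a(2) t(2)] t(2)
  have "s \<in> hom C S A'"
    using pullback_homs(2)[OF 2 comp_in_hom[OF a] comp_in_hom[OF t]] .
  note t2 = a(1) this t(1)
  have qt: "q \<cdot> t \<in> hom C S B" using t comp_in_hom by blast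
  note c1 = pullback_commutes[OF 1] and c2 = pullback_commutes[OF 2]
  show ?thesis
  proof (rule pullbackI[OF t2(1) t1(3) t2(2,3) eq])
    fix Z x y assume x: "x \<in> hom C Z A'" and y: "y \<in> hom C Z P" and e: "a \<cdot> x = p \<cdot> y"
    have "(f \<cdot> a) \<cdot> x = g \<cdot> (q \<cdot> y)" using x y e t1 t2 by (simp add: cat_simps comp_extend[OF c1])
    then obtain k where k: "k \<in> hom C Z S" "s \<cdot> k = x" "(q \<cdot> t) \<cdot> k = q \<cdot> y"
      using pullback_lift[OF 2 t2(2) qt x] comp_in_hom[OF y t1(4)] by metis
    have tk: "t \<cdot> k \<in> hom C Z P" using k t2 comp_in_hom by blast
    have "p \<cdot> (t \<cdot> k) = p \<cdot> y"
      using k t1 t2 e by (simp add: cat_simps comp_extend[OF eq[symmetric]])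
    moreover have "q \<cdot> (t \<cdot> k) = q \<cdot> y" using k t1 t2 by (simp add: cat_simps)
    ultimately have "t \<cdot> k = y" using pullback_eqI[OF 1 t1(3) tk y] by blast
    with k show "\<exists>h\<in>hom C Z S. s \<cdot> h = x \<and> t \<cdot> h = y" by blast
  next
    fix Z h h' assume h: "h \<in> hom C Z S" "h' \<in> hom C Z S" and e: "s \<cdot> h = s \<cdot> h'" "t \<cdot> h = t \<cdot> h'"
    then have "(q \<cdot> t) \<cdot> h = (q \<cdot> t) \<cdot> h'" using t by (simp add: cat_simps)
    then show "h = h'" using pullback_eqI[OF 2 t2(2) h] e by blast
  qed
qed

end

text \<open>Facts about pushouts are the facts about pullbacks in the opposite category.\<close>

definition op_cat :: "('o, 'a) cat \<Rightarrow> ('o, 'a) cat" where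
  "op_cat C = \<lparr>Ob = Ob C, Ar = Ar C, Dom = Cod C, Cod = Dom C, Ident = Ident C,
     Comp = (\<lambda>g f. f \<cdot>\<^bsub>C\<^esub> g)\<rparr>"

lemma op_cat_simps [simp]:
  "Ob (op_cat C) = Ob C" "Ar (op_cat C) = Ar C" "Dom (op_cat C) = Cod C" "Cod (op_cat C) = Dom C"
  "Ident (op_cat C) = Ident C" "g \<cdot>\<^bsub>op_cat C\<^esub> f = f \<cdot>\<^bsub>C\<^esub> g"
  by (simp_all add: op_cat_def)

lemma hom_op_cat [simp]: "hom (op_cat C) A B = hom C B A"
  by (auto simp: hom_def)

lemma pushout_iff_op_pullback: "is_pushout C f g i j \<longleftrightarrow> is_pullback (op_cat C) f g i j"
  unfolding is_pushout_def is_pullback_def by auto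

section \<open>Dual facts for pushouts, and regular monomorphisms\<close>

context category
begin

lemma category_op_cat: "category (op_cat C)"
  by unfold_locales
    (auto simp: dom_in_Ob cod_in_Ob ident_in_hom comp_ident_left comp_ident_right intro: comp_in_hom comp_assoc[symmetric])

lemmas pushoutI = category.pullbackI[OF category_op_cat, folded pushout_iff_op_pullback, simplified]
  and pushout_typing = category.pullback_typing[OF category_op_cat, folded pushout_iff_op_pullback, simplified]
  and pushout_commutes = category.pullback_commutes[OF category_op_cat, folded pushout_iff_op_pullback, simplified]
  and pushout_desc = category.pullback_lift[OF category_op_cat, folded pushout_iff_op_pullback, simplified]
  and pushout_eqI = category.pullback_eqI[OF category_op_cat, folded pushout_iff_op_pullback, simplified]
  and pushout_sym = category.pullback_sym[OF category_op_cat, folded pushout_iff_op_pullback, simplified]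
  and pushout_paste = category.pullback_paste[OF category_op_cat, folded pushout_iff_op_pullback, simplified]
  and pushout_cancel = category.pullback_cancel[OF category_op_cat, folded pushout_iff_op_pullback, simplified]

lemma pullback_ident:
  assumes "\<alpha> \<in> hom C G X"
  shows "is_pullback C (Ident C X) \<alpha> \<alpha> (Ident C G)"
proof -
  have id: "Ident C X \<in> hom C X X" "Ident C G \<in> hom C G G"
    using assms hom_objs ident_in_hom by blast+
  show ?thesis
    by (rule pullbackI[OF id(1) assms assms id(2)])
      (use assms in \<open>simp_all add: comp_ident_left comp_ident_right\<close>)
qed

lemma regular_mono_arr: "m \<in> regular_monos C \<Longrightarrow> m \<in> Ar C"
  by (auto simp: regular_monos_def is_equalizer_def hom_def)

lemma regular_mono_hom: "m \<in> regular_monos C \<Longrightarrow> m \<in> hom C (Dom C m) (Cod C m)"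
  using regular_mono_arr by (simp add: hom_def)

lemma regular_mono_eqI:
  assumes "m \<in> regular_monos C" "m \<in> hom C A B" "h \<in> hom C Z A" "h' \<in> hom C Z A" "m \<cdot> h = m \<cdot> h'"
  shows "h = h'"
proof -
  obtain f g where eq: "is_equalizer C f g m" using assms(1) by (auto simp: regular_monos_def)
  then have "f \<in> hom C B (Cod C f)" "g \<in> hom C B (Cod C f)" "f \<cdot> m = g \<cdot> m" "Dom C m = A"
    using assms(2) by (auto simp: is_equalizer_def hom_def)
  moreover from this have "f \<cdot> (m \<cdot> h) = g \<cdot> (m \<cdot> h)" "m \<cdot> h \<in> hom C Z (Dom C f)"
    using assms(2,3) by (simp_all add: cat_simps comp_extend[of f m])
  then have "\<exists>!k. k \<in> hom C Z (Dom C m) \<and> m \<cdot> k = m \<cdot> h"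
    using eq unfolding is_equalizer_def by blast
  ultimately show ?thesis using assms(3,4,5) by metis
qed

text \<open>If \<open>m\<close> equalizes \<open>f\<close> and \<open>g\<close>, then its pullback
  along \<open>h\<close> equalizes \<open>f \<cdot> h\<close> and
  \<open>g \<cdot> h\<close>.\<close>

lemma regular_mono_pullback:
  assumes pb: "is_pullback C h m m' q" and m: "m \<in> regular_monos C"
  shows "m' \<in> regular_monos C"
proof -
  obtain f g where eq: "is_equalizer C f g m" using m by (auto simp: regular_monos_def)
  obtain A B X P where t: "h \<in> hom C A X" "m \<in> hom C B X" "m' \<in> hom C P A" "q \<in> hom C P B"
    using pb by (rule pullback_typing)
  define Y where "Y = Cod C f"
  have fg: "f \<in> hom C X Y" "g \<in> hom C X Y" "f \<cdot> m = g \<cdot> m"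
    using eq t by (auto simp: is_equalizer_def hom_def Y_def)
  note c = pullback_commutes[OF pb]
  have "is_equalizer C (f \<cdot> h) (g \<cdot> h) m'"
    unfolding is_equalizer_def
  proof (intro conjI allI impI)
    show "f \<cdot> h \<in> Ar C" "g \<cdot> h \<in> hom C (Dom C (f \<cdot> h)) (Cod C (f \<cdot> h))" "m' \<in> hom C (Dom C m') (Dom C (f \<cdot> h))"
      using t fg by (simp_all add: cat_simps)
    show "(f \<cdot> h) \<cdot> m' = (g \<cdot> h) \<cdot> m'"
      using t fg by (simp add: cat_simps c comp_extend[OF fg(3)])
  next
    fix Z a assume "a \<in> hom C Z (Dom C (f \<cdot> h)) \<and> (f \<cdot> h) \<cdot> a = (g \<cdot> h) \<cdot> a"
    then have a: "a \<in> hom C Z A" "(f \<cdot> h) \<cdot> a = (g \<cdot> h) \<cdot> a"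
      using t fg by (simp_all add: cat_simps)
    then have a: "a \<in> hom C Z A" "f \<cdot> (h \<cdot> a) = g \<cdot> (h \<cdot> a)" "h \<cdot> a \<in> hom C Z (Dom C f)"
      using t fg comp_assoc[OF a(1) t(1)] by (simp_all add: cat_simps)
    have "\<exists>!b. b \<in> hom C Z (Dom C m) \<and> m \<cdot> b = h \<cdot> a"
      using eq a(2,3) unfolding is_equalizer_def by blast
    then obtain b where "b \<in> hom C Z B" "m \<cdot> b = h \<cdot> a" using t by (auto simp: hom_def)
    then obtain k where k: "k \<in> hom C Z P" "m' \<cdot> k = a"
      using pullback_lift[OF pb t(3,4) a(1)] by metis
    moreover have "k' = k" if k': "k' \<in> hom C Z P" "m' \<cdot> k' = a" for k'
    proof -
      have "m \<cdot> (q \<cdot> k') = m \<cdot> (q \<cdot> k)"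
        using t k k' by (simp add: cat_simps comp_extend[OF c[symmetric]])
      then have "q \<cdot> k' = q \<cdot> k"
        using regular_mono_eqI[OF m t(2)] comp_in_hom[OF k(1) t(4)] comp_in_hom[OF k'(1) t(4)] by blast
      then show ?thesis using pullback_eqI[OF pb t(3) k'(1) k(1)] k k' by simp
    qed
    moreover have "Dom C m' = P" using t by (simp add: hom_def)
    ultimately show "\<exists>!k. k \<in> hom C Z (Dom C m') \<and> m' \<cdot> k = a" by metis
  qed
  then show ?thesis by (auto simp: regular_monos_def)
qed

end

section \<open>Partial products and stability of pushouts\<close>

context category
begin

lemma slice_simps [simp]:
  "Ob (slice C X) = {f \<in> Ar C. Cod C f = X}"
  "(f', h', g') \<cdot>\<^bsub>slice C X\<^esub> (f, h, g) = (f, h' \<cdot> h, g')"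
  by (simp_all add: slice_def)

lemma hom_slice_iff:
  "(f', h, g') \<in> hom (slice C X) f g \<longleftrightarrow>
    f' = f \<and> g' = g \<and> f \<in> Ar C \<and> Cod C f = X \<and> g \<in> Ar C \<and> Cod C g = X \<and>
    h \<in> hom C (Dom C f) (Dom C g) \<and> g \<cdot> h = f"
  by (auto simp: slice_def hom_def)

lemma slice_product_of_pullback:
  assumes pb: "is_pullback C f g p q" and f: "f \<in> hom C A X"
  shows "is_product (slice C X) f g (f \<cdot> p) (f \<cdot> p, p, f) (f \<cdot> p, q, g)"
proof -
  obtain B P where t: "g \<in> hom C B X" "p \<in> hom C P A" "q \<in> hom C P B"
    using pullback_typing[OF pb] hom_unique[OF f] by metis
  note c = pullback_commutes[OF pb]
  show ?thesis
    unfolding is_product_def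
  proof (intro conjI allI impI)
    show "(f \<cdot> p, p, f) \<in> hom (slice C X) (f \<cdot> p) f" "(f \<cdot> p, q, g) \<in> hom (slice C X) (f \<cdot> p) g"
      unfolding hom_slice_iff using t f c by (simp_all add: cat_simps)
  next
    fix z a b assume ab: "a \<in> hom (slice C X) z f \<and> b \<in> hom (slice C X) z g"
    obtain a0 b0 where a: "a = (z, a0, f)" and b: "b = (z, b0, g)"
      using ab by (cases a, cases b) (auto simp: hom_slice_iff)
    define Z where "Z = Dom C z"
    have t': "a0 \<in> hom C Z A" "b0 \<in> hom C Z B" "f \<cdot> a0 = z" "g \<cdot> b0 = z" "z \<in> hom C Z X"
      using ab f t unfolding a b hom_slice_iff by (simp_all add: hom_def Z_def)
    then obtain h where h: "h \<in> hom C Z P" "p \<cdot> h = a0" "q \<cdot> h = b0"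
      using pullback_lift[OF pb t(2,3)] by metis
    show "\<exists>!h. h \<in> hom (slice C X) z (f \<cdot> p) \<and> (f \<cdot> p, p, f) \<cdot>\<^bsub>slice C X\<^esub> h = a \<and> (f \<cdot> p, q, g) \<cdot>\<^bsub>slice C X\<^esub> h = b"
    proof (rule ex1I[of _ "(z, h, f \<cdot> p)"])
      show "(z, h, f \<cdot> p) \<in> hom (slice C X) z (f \<cdot> p) \<and> (f \<cdot> p, p, f) \<cdot>\<^bsub>slice C X\<^esub> (z, h, f \<cdot> p) = a \<and>
        (f \<cdot> p, q, g) \<cdot>\<^bsub>slice C X\<^esub> (z, h, f \<cdot> p) = b"
        unfolding a b hom_slice_iff using t t' h f by (simp add: cat_simps)
    next
      fix k assume k: "k \<in> hom (slice C X) z (f \<cdot> p) \<and> (f \<cdot> p, p, f) \<cdot>\<^bsub>slice C X\<^esub> k = a \<and>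
        (f \<cdot> p, q, g) \<cdot>\<^bsub>slice C X\<^esub> k = b"
      obtain k0 where k0: "k = (z, k0, f \<cdot> p)" using k by (cases k) (auto simp: hom_slice_iff)
      have "k0 \<in> hom C Z P" "p \<cdot> k0 = a0" "q \<cdot> k0 = b0"
        using k f t unfolding k0 a b hom_slice_iff by (simp_all add: cat_simps Z_def)
      then have "k0 = h" using pullback_eqI[OF pb t(2) _ h(1)] h by simp
      then show "k = (z, h, f \<cdot> p)" by (simp add: k0)
    qed
  qed
qed

lemma pullback_of_slice_product:
  assumes prod: "is_product (slice C X) f g w p' q'"
  obtains p q where "p' = (w, p, f)" "q' = (w, q, g)" "is_pullback C f g p q" "w = f \<cdot> p"
proof -
  obtain p q where pq: "p' = (w, p, f)" "q' = (w, q, g)"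
    using prod unfolding is_product_def by (cases p', cases q') (auto simp: hom_slice_iff)
  define A B P where "A = Dom C f" and "B = Dom C g" and "P = Dom C w"
  have "f \<in> hom C A X" "g \<in> hom C B X" "p \<in> hom C P A" "q \<in> hom C P B" "f \<cdot> p = w" "g \<cdot> q = w" "w \<in> hom C P X"
    using prod unfolding is_product_def pq hom_slice_iff by (auto simp: hom_def A_def B_def P_def)
  note t = this
  have univ: "\<exists>!h. h \<in> hom (slice C X) z w \<and> p' \<cdot>\<^bsub>slice C X\<^esub> h = a \<and> q' \<cdot>\<^bsub>slice C X\<^esub> h = b"
    if "a \<in> hom (slice C X) z f" "b \<in> hom (slice C X) z g" for z a b
    using prod that unfolding is_product_def by blast
  have "is_pullback C f g p q"
  proof (rule pullbackI[OF t(1-4)])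
    show "f \<cdot> p = g \<cdot> q" using t by simp
  next
    fix Z a b assume ab: "a \<in> hom C Z A" "b \<in> hom C Z B" "f \<cdot> a = g \<cdot> b"
    have "(f \<cdot> a, a, f) \<in> hom (slice C X) (f \<cdot> a) f" "(f \<cdot> a, b, g) \<in> hom (slice C X) (f \<cdot> a) g"
      using ab t(1,2) unfolding hom_slice_iff by (simp_all add: cat_simps)
    from univ[OF this] obtain h where
      h: "h \<in> hom (slice C X) (f \<cdot> a) w" "p' \<cdot>\<^bsub>slice C X\<^esub> h = (f \<cdot> a, a, f)" "q' \<cdot>\<^bsub>slice C X\<^esub> h = (f \<cdot> a, b, g)"
      by blast
    obtain h0 where "h = (f \<cdot> a, h0, w)" using h(1) by (cases h) (auto simp: hom_slice_iff)
    then have "h0 \<in> hom C Z P" "p \<cdot> h0 = a" "q \<cdot> h0 = b"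
      using h t ab unfolding pq by (simp_all add: hom_slice_iff comp_arr hom_def[of C])
    then show "\<exists>h\<in>hom C Z P. p \<cdot> h = a \<and> q \<cdot> h = b" by blast
  next
    fix Z h h' assume h: "h \<in> hom C Z P" "h' \<in> hom C Z P" and eq: "p \<cdot> h = p \<cdot> h'" "q \<cdot> h = q \<cdot> h'"
    \<comment> \<open>Slice arrows carry their end points, so \<open>h\<close> and \<open>h'\<close>
      can be compared there only once they are known to start from the same object over
      \<open>X\<close>.\<close>
    have wh: "w \<cdot> h = w \<cdot> h'"
      using comp_assoc[OF h(1) t(3,1)] comp_assoc[OF h(2) t(3,1)] eq t(5) by simp
    have "(w \<cdot> h, p \<cdot> h, f) \<in> hom (slice C X) (w \<cdot> h) f" "(w \<cdot> h, q \<cdot> h, g) \<in> hom (slice C X) (w \<cdot> h) g"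
      using h t unfolding hom_slice_iff by (simp_all add: cat_simps comp_extend[OF t(5)] comp_extend[OF t(6)])
    from univ[OF this] have "\<exists>!k. k \<in> hom (slice C X) (w \<cdot> h) w \<and>
      p' \<cdot>\<^bsub>slice C X\<^esub> k = (w \<cdot> h, p \<cdot> h, f) \<and> q' \<cdot>\<^bsub>slice C X\<^esub> k = (w \<cdot> h, q \<cdot> h, g)" .
    moreover have "(w \<cdot> h, h, w) \<in> hom (slice C X) (w \<cdot> h) w" "(w \<cdot> h, h', w) \<in> hom (slice C X) (w \<cdot> h) w"
      using h t wh unfolding hom_slice_iff by (simp_all add: cat_simps)
    moreover have "p' \<cdot>\<^bsub>slice C X\<^esub> (w \<cdot> h, h, w) = (w \<cdot> h, p \<cdot> h, f)" "q' \<cdot>\<^bsub>slice C X\<^esub> (w \<cdot> h, h, w) = (w \<cdot> h, q \<cdot> h, g)"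
      "p' \<cdot>\<^bsub>slice C X\<^esub> (w \<cdot> h, h', w) = (w \<cdot> h, p \<cdot> h, f)" "q' \<cdot>\<^bsub>slice C X\<^esub> (w \<cdot> h, h', w) = (w \<cdot> h, q \<cdot> h, g)"
      using eq by (simp_all add: pq)
    ultimately have "(w \<cdot> h, h, w) = (w \<cdot> h, h', w)" by blast
    then show "h = h'" by simp
  qed
  with pq t that show thesis by simp
qed

text \<open>Arrows \<open>h \<rightarrow> e\<close> over \<open>Cod e\<close> correspond to arrows into \<open>Z\<close> from the pullback of \<open>h\<close> along \<open>\<alpha>\<close>. For
  \<open>\<alpha> = true\<close> this is exactly the partial map classifier of \<open>Z\<close>.\<close>

definition is_partial_product :: "'a \<Rightarrow> 'o \<Rightarrow> 'a \<Rightarrow> 'a \<Rightarrow> 'a \<Rightarrow> 'a \<Rightarrow> bool" where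
  "is_partial_product \<alpha> Z e p q ev \<longleftrightarrow>
     is_pullback C e \<alpha> p q \<and> ev \<in> hom C (Dom C p) Z \<and>
     (\<forall>h s t f. is_pullback C h \<alpha> s t \<and> f \<in> hom C (Dom C s) Z \<longrightarrow>
        (\<exists>!g. g \<in> hom C (Dom C h) (Dom C e) \<and> e \<cdot> g = h \<and>
           (\<exists>k\<in>hom C (Dom C s) (Dom C p). p \<cdot> k = g \<cdot> s \<and> q \<cdot> k = t \<and> ev \<cdot> k = f)))"

lemma partial_product_ex1:
  assumes pp: "is_partial_product \<alpha> Z e p q ev" and t: "e \<in> hom C E X" "p \<in> hom C P E"
    and pb: "is_pullback C h \<alpha> s t" "h \<in> hom C A X" "s \<in> hom C Q A" and f: "f \<in> hom C Q Z"
  shows "\<exists>!g. g \<in> hom C A E \<and> e \<cdot> g = h \<and> (\<exists>k\<in>hom C Q P. p \<cdot> k = g \<cdot> s \<and> q \<cdot> k = t \<and> ev \<cdot> k = f)"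
proof -
  have eqs: "Dom C h = A" "Dom C e = E" "Dom C s = Q" "Dom C p = P" using t pb by (simp_all add: hom_def)
  have "is_pullback C h \<alpha> s t \<and> f \<in> hom C (Dom C s) Z" using pb f eqs by simp
  with pp have "\<exists>!g. g \<in> hom C (Dom C h) (Dom C e) \<and> e \<cdot> g = h \<and>
      (\<exists>k\<in>hom C (Dom C s) (Dom C p). p \<cdot> k = g \<cdot> s \<and> q \<cdot> k = t \<and> ev \<cdot> k = f)"
    unfolding is_partial_product_def by blast
  then show ?thesis unfolding eqs .
qed

lemma partial_product_transpose:
  assumes "is_partial_product \<alpha> Z e p q ev" and "e \<in> hom C E X" "p \<in> hom C P E"
    and "is_pullback C h \<alpha> s t" "h \<in> hom C A X" "s \<in> hom C Q A" and "f \<in> hom C Q Z"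
  obtains g k where "g \<in> hom C A E" "e \<cdot> g = h" "k \<in> hom C Q P" "p \<cdot> k = g \<cdot> s" "q \<cdot> k = t" "ev \<cdot> k = f"
  using partial_product_ex1[OF assms] that by blast

text \<open>Extensionality for arrows into \<open>E\<close> over \<open>X\<close>: it is enough that
  their transposes to \<open>Z\<close> agree. The lifts \<open>k\<close> and \<open>k'\<close> are
  explicit so that composites of known lifts can be supplied.\<close>

lemma partial_product_unique:
  assumes pp: "is_partial_product \<alpha> Z e p q ev" and t: "e \<in> hom C E X" "p \<in> hom C P E"
    and pb: "is_pullback C h \<alpha> s t" "h \<in> hom C A X" "s \<in> hom C Q A"
    and g: "g \<in> hom C A E" "e \<cdot> g = h" "k \<in> hom C Q P" "p \<cdot> k = g \<cdot> s" "q \<cdot> k = t"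
    and g': "g' \<in> hom C A E" "e \<cdot> g' = h" "k' \<in> hom C Q P" "p \<cdot> k' = g' \<cdot> s" "q \<cdot> k' = t"
    and ev: "ev \<cdot> k = ev \<cdot> k'"
  shows "g = g'"
proof -
  have "ev \<in> hom C P Z" using pp t by (simp add: is_partial_product_def hom_def)
  from comp_in_hom[OF g(3) this] show ?thesis
    using partial_product_ex1[OF pp t pb] g g' ev by (metis (no_types, lifting))
qed

end

section \<open>Pullbacks, products and partial products from the slices; stability\<close>

context quasitopos
begin

lemma pullback_exists:
  assumes "f \<in> hom C A X" "g \<in> hom C B X"
  obtains P p q where "p \<in> hom C P A" "q \<in> hom C P B" "is_pullback C f g p q"
proof -
  have "X \<in> Ob C" using assms(1) hom_objs by blast
  then have "cartesian_closed (slice C X)"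
    using locally_cartesian_closed by (simp add: locally_cartesian_closed_def)
  moreover have "f \<in> Ob (slice C X)" "g \<in> Ob (slice C X)" using assms by (simp_all add: hom_def)
  ultimately obtain w p' q' where "is_product (slice C X) f g w p' q'"
    unfolding cartesian_closed_def by blast
  then obtain p q where pb: "is_pullback C f g p q" by (rule pullback_of_slice_product)
  show thesis
    using pb by (rule pullback_typing) (use assms pb hom_unique that in metis)
qed

text \<open>A product is a pullback over the terminal object.\<close>

lemma product_exists:
  assumes "A \<in> Ob C" "B \<in> Ob C"
  obtains P p q where "is_product C A B P p q"
proof -
  obtain one where one: "is_terminal C one"
    using regular_subobject_classifier unfolding is_regular_subobject_classifier_def by blast
  then have ex: "\<exists>!h. h \<in> hom C Y one" if "Y \<in> Ob C" for Y
    using that unfolding is_terminal_def by blast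
  obtain f g where fg: "f \<in> hom C A one" "g \<in> hom C B one" using ex assms by blast
  obtain P p q where t: "p \<in> hom C P A" "q \<in> hom C P B" and pb: "is_pullback C f g p q"
    using pullback_exists[OF fg] .
  have "\<exists>!h. h \<in> hom C Z P \<and> p \<cdot> h = a \<and> q \<cdot> h = b" if ab: "a \<in> hom C Z A" "b \<in> hom C Z B" for Z a b
  proof -
    have "f \<cdot> a = g \<cdot> b" using ex[of Z] comp_in_hom ab fg hom_objs by metis
    then obtain h where "h \<in> hom C Z P" "p \<cdot> h = a" "q \<cdot> h = b"
      using pullback_lift[OF pb t ab] by blast
    then show ?thesis using pullback_eqI[OF pb t(1)] by metis
  qed
  then show thesis using that t unfolding is_product_def by blast
qed

text \<open>The exponential of \<open>Z \<times> P \<rightarrow> P\<close> by \<open>\<alpha>\<close> in the slice over \<open>P\<close>.\<close>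

lemma partial_product_exists:
  assumes \<alpha>: "\<alpha> \<in> hom C G X" and Z: "Z \<in> Ob C"
  obtains E P e p q ev where "e \<in> hom C E X" "p \<in> hom C P E" "q \<in> hom C P G" "ev \<in> hom C P Z"
    "is_partial_product \<alpha> Z e p q ev"
proof -
  have X: "X \<in> Ob C" using \<alpha> hom_objs by blast
  obtain W \<pi> \<rho> where W: "is_product C Z X W \<pi> \<rho>" using product_exists[OF Z X] .
  then have tW: "\<pi> \<in> hom C W Z" "\<rho> \<in> hom C W X"
    and uW: "\<And>Y a b. a \<in> hom C Y Z \<Longrightarrow> b \<in> hom C Y X \<Longrightarrow> \<exists>!h. h \<in> hom C Y W \<and> \<pi> \<cdot> h = a \<and> \<rho> \<cdot> h = b"
    unfolding is_product_def by auto
  have "cartesian_closed (slice C X)"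
    using locally_cartesian_closed X by (simp add: locally_cartesian_closed_def)
  moreover have "\<alpha> \<in> Ob (slice C X)" "\<rho> \<in> Ob (slice C X)" using \<alpha> tW by (simp_all add: hom_def)
  ultimately obtain e w p' q' ev' where ex: "is_exponential (slice C X) \<alpha> \<rho> e w p' q' ev'"
    unfolding cartesian_closed_def by blast
  then have prod: "is_product (slice C X) e \<alpha> w p' q'" and ev': "ev' \<in> hom (slice C X) w \<rho>"
    unfolding is_exponential_def by auto
  obtain p q where pq: "p' = (w, p, e)" "q' = (w, q, \<alpha>)" and pb: "is_pullback C e \<alpha> p q" and w: "w = e \<cdot> p"
    using prod by (rule pullback_of_slice_product)
  obtain ev0 where ev0: "ev' = (w, ev0, \<rho>)" using ev' by (cases ev') (auto simp: hom_slice_iff)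
  define E P where "E = Dom C e" and "P = Dom C p"
  have t: "e \<in> hom C E X" "p \<in> hom C P E" "q \<in> hom C P G"
    using pb \<alpha> unfolding is_pullback_def by (simp_all add: hom_def E_def P_def)
  have tev: "ev0 \<in> hom C P W" "\<rho> \<cdot> ev0 = w"
    using ev' t w tW unfolding ev0 hom_slice_iff by (simp_all add: comp_arr hom_def)
  have "is_partial_product \<alpha> Z e p q (\<pi> \<cdot> ev0)"
    unfolding is_partial_product_def
  proof (intro conjI allI impI)
    show "\<pi> \<cdot> ev0 \<in> hom C (Dom C p) Z" using tev tW t by (simp add: cat_simps)
  next
    fix h s t' f assume asm: "is_pullback C h \<alpha> s t' \<and> f \<in> hom C (Dom C s) Z"
    then have pbh: "is_pullback C h \<alpha> s t'" ..
    define A Q where "A = Dom C h" and "Q = Dom C s"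
    have th: "h \<in> hom C A X" "s \<in> hom C Q A" "t' \<in> hom C Q G" "f \<in> hom C Q Z"
      using asm \<alpha> by (auto simp: is_pullback_def hom_def A_def Q_def)
    have hs: "h \<cdot> s \<in> hom C Q X" using th comp_in_hom by blast
    \<comment> \<open>Pairing \<open>f\<close> with the structure map \<open>h \<cdot> s\<close>
      makes it an arrow over \<open>X\<close> into \<open>\<rho>\<close>, to which the exponential
      applies.\<close>
    obtain F where F: "F \<in> hom C Q W" "\<pi> \<cdot> F = f" "\<rho> \<cdot> F = h \<cdot> s"
      using uW[OF th(4) hs] by blast
    have "(h \<cdot> s, F, \<rho>) \<in> hom (slice C X) (h \<cdot> s) \<rho>"
      unfolding hom_slice_iff using F hs tW by (simp add: hom_def)
    with slice_product_of_pullback[OF pbh th(1)]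
    have ex1: "\<exists>!g'. g' \<in> hom (slice C X) h e \<and> (\<exists>h'\<in>hom (slice C X) (h \<cdot> s) w.
        p' \<cdot>\<^bsub>slice C X\<^esub> h' = g' \<cdot>\<^bsub>slice C X\<^esub> (h \<cdot> s, s, h) \<and> q' \<cdot>\<^bsub>slice C X\<^esub> h' = (h \<cdot> s, t', \<alpha>) \<and>
        ev' \<cdot>\<^bsub>slice C X\<^esub> h' = (h \<cdot> s, F, \<rho>))" (is "\<exists>!g'. ?S g'")
      using ex unfolding is_exponential_def by blast
    have iff: "?S (h, g, e) \<longleftrightarrow> g \<in> hom C A E \<and> e \<cdot> g = h \<and>
        (\<exists>k\<in>hom C Q P. p \<cdot> k = g \<cdot> s \<and> q \<cdot> k = t' \<and> (\<pi> \<cdot> ev0) \<cdot> k = f)" (is "_ \<longleftrightarrow> ?T g") for g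
    proof
      assume S: "?S (h, g, e)"
      have g: "g \<in> hom C A E" "e \<cdot> g = h"
        using S unfolding hom_slice_iff by (simp_all add: A_def E_def)
      from S obtain h' where h': "h' \<in> hom (slice C X) (h \<cdot> s) w"
        "p' \<cdot>\<^bsub>slice C X\<^esub> h' = (h, g, e) \<cdot>\<^bsub>slice C X\<^esub> (h \<cdot> s, s, h)" "q' \<cdot>\<^bsub>slice C X\<^esub> h' = (h \<cdot> s, t', \<alpha>)"
        "ev' \<cdot>\<^bsub>slice C X\<^esub> h' = (h \<cdot> s, F, \<rho>)" by blast
      obtain k where k: "h' = (h \<cdot> s, k, w)" using h'(1) by (cases h') (auto simp: hom_slice_iff)
      have "k \<in> hom C Q P" "p \<cdot> k = g \<cdot> s" "q \<cdot> k = t'" "ev0 \<cdot> k = F"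
        using h' hs t w unfolding k pq ev0 hom_slice_iff by (simp_all add: comp_arr hom_def)
      moreover from this have "(\<pi> \<cdot> ev0) \<cdot> k = f"
        using comp_assoc[OF _ tev(1) tW(1)] F by simp
      ultimately show "?T g" using g by blast
    next
      assume T: "?T g"
      then have g: "g \<in> hom C A E" "e \<cdot> g = h" by auto
      from T obtain k where k: "k \<in> hom C Q P" "p \<cdot> k = g \<cdot> s" "q \<cdot> k = t'" "(\<pi> \<cdot> ev0) \<cdot> k = f" by blast
      have wk: "w \<cdot> k = h \<cdot> s"
        using t k g th by (simp add: w cat_simps comp_extend[OF g(2)])
      have "ev0 \<cdot> k = F"
      proof -
        have "\<pi> \<cdot> (ev0 \<cdot> k) = f" "\<rho> \<cdot> (ev0 \<cdot> k) = h \<cdot> s" "ev0 \<cdot> k \<in> hom C Q W"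
          using comp_assoc[OF k(1) tev(1) tW(1)] comp_assoc[OF k(1) tev(1) tW(2)] tev(2) k wk
            comp_in_hom[OF k(1) tev(1)] by simp_all
        then show ?thesis using F uW[OF th(4) hs] by blast
      qed
      moreover have "(h \<cdot> s, k, w) \<in> hom (slice C X) (h \<cdot> s) w" "(h, g, e) \<in> hom (slice C X) h e"
        unfolding hom_slice_iff using wk hs k t th g w by (simp_all add: cat_simps)
      ultimately show "?S (h, g, e)"
        using k by (intro conjI bexI[of _ "(h \<cdot> s, k, w)"]) (simp_all add: pq ev0)
    qed
    from ex1 obtain g' where S: "?S g'" and un: "\<And>x. ?S x \<Longrightarrow> x = g'" by blast
    obtain g where g: "g' = (h, g, e)" using S by (cases g') (auto simp: hom_slice_iff)
    have "?T g" using S unfolding g by (simp only: iff)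
    moreover have "g1 = g" if "?T g1" for g1
    proof -
      have "?S (h, g1, e)" using that by (simp only: iff)
      then have "(h, g1, e) = g'" by (rule un)
      then show ?thesis by (simp add: g)
    qed
    ultimately show "\<exists>!g. g \<in> hom C (Dom C h) (Dom C e) \<and> e \<cdot> g = h \<and>
        (\<exists>k\<in>hom C (Dom C s) (Dom C p). p \<cdot> k = g \<cdot> s \<and> q \<cdot> k = t' \<and> (\<pi> \<cdot> ev0) \<cdot> k = f)"
      unfolding A_def[symmetric] E_def[symmetric] P_def[symmetric] Q_def[symmetric]
      by (rule ex1I)
  qed (rule pb)
  moreover have "\<pi> \<cdot> ev0 \<in> hom C P Z" using tev tW comp_in_hom by blast
  ultimately show thesis using that t by blast
qed

text \<open>A cocone from the pulled-back span to \<open>Z\<close> transposes to a cocone from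
  \<open>(f, g)\<close> to the partial product \<open>E\<close>. The given pushout glues that one,
  and the result transposes back to an arrow from \<open>G\<close>. Uniqueness travels the same
  way.\<close>

lemma pushout_stable:
  assumes po: "is_pushout C f g i j"
    and t: "f \<in> hom C K A" "g \<in> hom C K B" "i \<in> hom C A X" "j \<in> hom C B X" "\<alpha> \<in> hom C G X"
    and t': "f' \<in> hom C K' A'" "g' \<in> hom C K' B'" "i' \<in> hom C A' G" "j' \<in> hom C B' G"
    and pA: "is_pullback C i \<alpha> a i'" and pB: "is_pullback C j \<alpha> b j'" and pK: "is_pullback C (i \<cdot> f) \<alpha> k k'"
    and sq: "a \<cdot> f' = f \<cdot> k" "b \<cdot> g' = g \<cdot> k" "i' \<cdot> f' = k'" "j' \<cdot> g' = k'"
  shows "is_pushout C f' g' i' j'"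
proof -
  have tif: "i \<cdot> f \<in> hom C K X" using t comp_in_hom by blast
  have t2: "i' \<in> hom C A' G" "a \<in> hom C A' A" "j' \<in> hom C B' G" "b \<in> hom C B' B" "k' \<in> hom C K' G" "k \<in> hom C K' K"
  proof -
    show "i' \<in> hom C A' G" "j' \<in> hom C B' G" "k' \<in> hom C K' G" using t' sq comp_in_hom by blast+
    then show "a \<in> hom C A' A" "b \<in> hom C B' B" "k \<in> hom C K' K"
      using pullback_homs(2) pA pB pK t(3,4) tif by blast+
  qed
  note c = pushout_commutes[OF po]
  note cA = pullback_commutes[OF pA] and cB = pullback_commutes[OF pB]
  show ?thesis
  proof (rule pushoutI[OF t'])
    show "i' \<cdot> f' = j' \<cdot> g'" using sq by simp
  next
    fix Z x y assume xy: "x \<in> hom C A' Z" "y \<in> hom C B' Z" "x \<cdot> f' = y \<cdot> g'"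
    have Z: "Z \<in> Ob C" using xy hom_objs by blast
    obtain E P e p q ev where u: "e \<in> hom C E X" "p \<in> hom C P E" "q \<in> hom C P G" "ev \<in> hom C P Z"
      and pp: "is_partial_product \<alpha> Z e p q ev"
      by (rule partial_product_exists[OF t(5) Z])
    have pe: "is_pullback C e \<alpha> p q" using pp by (simp add: is_partial_product_def)
    obtain gx kx where gx: "gx \<in> hom C A E" "e \<cdot> gx = i" "kx \<in> hom C A' P" "p \<cdot> kx = gx \<cdot> a" "q \<cdot> kx = i'" "ev \<cdot> kx = x"
      using partial_product_transpose[OF pp u(1,2) pA t(3) t2(2) xy(1)] .
    obtain gy ky where gy: "gy \<in> hom C B E" "e \<cdot> gy = j" "ky \<in> hom C B' P" "p \<cdot> ky = gy \<cdot> b" "q \<cdot> ky = j'" "ev \<cdot> ky = y"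
      using partial_product_transpose[OF pp u(1,2) pB t(4) t2(4) xy(2)] .
    \<comment> \<open>Both sides lie over \<open>i \<cdot> f\<close>; their transposes live on
      \<open>K'\<close> and are \<open>x \<cdot> f'\<close> and \<open>y \<cdot> g'\<close>.\<close>
    have "gx \<cdot> f = gy \<cdot> g"
    proof (rule partial_product_unique[OF pp u(1,2) pK tif t2(6)])
      show "gx \<cdot> f \<in> hom C K E" "kx \<cdot> f' \<in> hom C K' P" "gy \<cdot> g \<in> hom C K E" "ky \<cdot> g' \<in> hom C K' P"
        using gx gy t t' comp_in_hom by blast+
      show "e \<cdot> (gx \<cdot> f) = i \<cdot> f" "e \<cdot> (gy \<cdot> g) = i \<cdot> f"
        using gx gy t u by (simp_all add: hom_def comp_extend[OF gx(2)] comp_extend[OF gy(2)] c)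
      show "p \<cdot> (kx \<cdot> f') = (gx \<cdot> f) \<cdot> k" "p \<cdot> (ky \<cdot> g') = (gy \<cdot> g) \<cdot> k"
        using gx gy t u t2 t' by (simp_all add: cat_simps sq comp_extend[OF gx(4)] comp_extend[OF gy(4)])
      show "q \<cdot> (kx \<cdot> f') = k'" "q \<cdot> (ky \<cdot> g') = k'"
        using gx gy t u t' by (simp_all add: hom_def sq comp_extend[OF gx(5)] comp_extend[OF gy(5)])
      show "ev \<cdot> (kx \<cdot> f') = ev \<cdot> (ky \<cdot> g')"
        using gx gy t u t' by (simp add: hom_def xy comp_extend[OF gx(6)] comp_extend[OF gy(6)])
    qed
    then obtain H where H: "H \<in> hom C X E" "H \<cdot> i = gx" "H \<cdot> j = gy"
      using pushout_desc[OF po t(3,4) gx(1) gy(1)] by metis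
    have X: "X \<in> Ob C" using t hom_objs by blast
    \<comment> \<open>\<open>H\<close> is a section of \<open>e\<close>. As the identity of
      \<open>X\<close> pulls back along \<open>\<alpha>\<close> to the identity of \<open>G\<close>,
      a section transposes to an arrow \<open>G \<rightarrow> Z\<close>.\<close>
    have eH: "e \<cdot> H = Ident C X"
    proof (rule pushout_eqI[OF po t(3)])
      show "e \<cdot> H \<in> hom C X X" "Ident C X \<in> hom C X X" using H u X comp_in_hom ident_in_hom by blast+
      show "(e \<cdot> H) \<cdot> i = Ident C X \<cdot> i" "(e \<cdot> H) \<cdot> j = Ident C X \<cdot> j"
        using comp_assoc[OF t(3) H(1) u(1)] comp_assoc[OF t(4) H(1) u(1)] H gx gy t by (simp_all add: comp_ident_left)
    qed
    have G: "G \<in> Ob C" using t hom_objs by blast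
    have "e \<cdot> (H \<cdot> \<alpha>) = \<alpha> \<cdot> Ident C G"
      using comp_assoc[OF t(5) H(1) u(1)] eH t by (simp add: comp_ident_left comp_ident_right)
    then obtain l where l: "l \<in> hom C G P" "p \<cdot> l = H \<cdot> \<alpha>" "q \<cdot> l = Ident C G"
      using pullback_lift[OF pe u(2,3) comp_in_hom[OF t(5) H(1)] ident_in_hom[OF G]] by blast
    have "l \<cdot> i' = kx"
      by (rule pullback_eqI[OF pe u(2) _ gx(3)])
        (use l t2 t u H gx G in \<open>simp_all add: cat_simps comp_extend[OF l(2)] comp_extend[OF l(3)]
          cA[symmetric] comp_extend[OF H(2)] comp_ident_left[unfolded hom_def]\<close>)
    moreover have "l \<cdot> j' = ky"
      by (rule pullback_eqI[OF pe u(2) _ gy(3)])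
        (use l t2 t u H gy G in \<open>simp_all add: cat_simps comp_extend[OF l(2)] comp_extend[OF l(3)]
          cB[symmetric] comp_extend[OF H(3)] comp_ident_left[unfolded hom_def]\<close>)
    ultimately have "(ev \<cdot> l) \<cdot> i' = x" "(ev \<cdot> l) \<cdot> j' = y" "ev \<cdot> l \<in> hom C G Z"
      using l u t2 gx(6) gy(6) by (simp_all add: cat_simps)
    then show "\<exists>h\<in>hom C G Z. h \<cdot> i' = x \<and> h \<cdot> j' = y" by blast
  next
    fix Z z z' assume z: "z \<in> hom C G Z" "z' \<in> hom C G Z" "z \<cdot> i' = z' \<cdot> i'" "z \<cdot> j' = z' \<cdot> j'"
    have Z: "Z \<in> Ob C" using z hom_objs by blast
    obtain E P e p q ev where u: "e \<in> hom C E X" "p \<in> hom C P E" "q \<in> hom C P G" "ev \<in> hom C P Z"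
      and pp: "is_partial_product \<alpha> Z e p q ev"
      by (rule partial_product_exists[OF t(5) Z])
    have pe: "is_pullback C e \<alpha> p q" using pp by (simp add: is_partial_product_def)
    have ob: "X \<in> Ob C" "G \<in> Ob C" using t hom_objs by blast+
    then have idX: "Ident C X \<in> hom C X X" using ident_in_hom by blast
    \<comment> \<open>Over this square \<open>z\<close> and \<open>z'\<close> become sections of
      \<open>e\<close>, and sections can be compared on the original pushout
      \<open>X\<close>.\<close>
    have pid: "is_pullback C (Ident C X) \<alpha> \<alpha> (Ident C G)" using pullback_ident[OF t(5)] .
    obtain H l where H: "H \<in> hom C X E" "e \<cdot> H = Ident C X" "l \<in> hom C G P" "p \<cdot> l = H \<cdot> \<alpha>" "q \<cdot> l = Ident C G" "ev \<cdot> l = z"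
      using partial_product_transpose[OF pp u(1,2) pid idX t(5) z(1)] .
    obtain H' l' where H': "H' \<in> hom C X E" "e \<cdot> H' = Ident C X" "l' \<in> hom C G P" "p \<cdot> l' = H' \<cdot> \<alpha>" "q \<cdot> l' = Ident C G" "ev \<cdot> l' = z'"
      using partial_product_transpose[OF pp u(1,2) pid idX t(5) z(2)] .
    have "H \<cdot> i = H' \<cdot> i"
      by (rule partial_product_unique[OF pp u(1,2) pA t(3) t2(2), of _ "l \<cdot> i'" _ "l' \<cdot> i'"])
        (use H H' t t2 u z in \<open>simp_all add: cat_simps cA comp_extend[OF H(2)] comp_extend[OF H'(2)]
          comp_extend[OF H(4)] comp_extend[OF H'(4)] comp_extend[OF H(5)] comp_extend[OF H'(5)]
          comp_extend[OF H(6)] comp_extend[OF H'(6)] comp_ident_left[unfolded hom_def]\<close>)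
    moreover have "H \<cdot> j = H' \<cdot> j"
      by (rule partial_product_unique[OF pp u(1,2) pB t(4) t2(4), of _ "l \<cdot> j'" _ "l' \<cdot> j'"])
        (use H H' t t2 u z in \<open>simp_all add: cat_simps cB comp_extend[OF H(2)] comp_extend[OF H'(2)]
          comp_extend[OF H(4)] comp_extend[OF H'(4)] comp_extend[OF H(5)] comp_extend[OF H'(5)]
          comp_extend[OF H(6)] comp_extend[OF H'(6)] comp_ident_left[unfolded hom_def]\<close>)
    ultimately have "H = H'" using pushout_eqI[OF po t(3) H(1) H'(1)] by blast
    then have "l = l'" using pullback_eqI[OF pe u(2) H(3) H'(3)] H H' by simp
    then show "z = z'" using H H' by simp
  qed
qed

end

section \<open>The partial map classifier\<close>

context category
begin

lemma comp_ident_arr: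
  assumes "f \<in> Ar C"
  shows "Dom C f = A \<Longrightarrow> f \<cdot> Ident C A = f" "Cod C f = A \<Longrightarrow> Ident C A \<cdot> f = f"
  using assms comp_ident_left[of f "Dom C f" "Cod C f"] comp_ident_right[of f "Dom C f" "Cod C f"]
  by (auto simp: hom_def)

lemma terminal_morphism:
  assumes "is_terminal C X" "Y \<in> Ob C"
  obtains h where "h \<in> hom C Y X"
  using assms unfolding is_terminal_def by blast

lemma terminal_eqI:
  assumes "is_terminal C X" "h \<in> hom C Y X" "h' \<in> hom C Y X"
  shows "h = h'"
  using assms hom_objs(1)[OF assms(2)] unfolding is_terminal_def by blast

text \<open>The arrow \<open>b\<close> to the terminal object splits \<open>m\<close>, and a split
  mono is the equalizer of the identity and the idempotent \<open>m \<cdot> b\<close>.\<close>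

lemma regular_mono_from_terminal:
  assumes X: "is_terminal C X" and m: "m \<in> hom C X A"
  shows "m \<in> regular_monos C"
proof -
  have A: "A \<in> Ob C" using m hom_objs by blast
  obtain b where b: "b \<in> hom C A X" using terminal_morphism[OF X A] .
  have idA: "Ident C A \<in> hom C A A" using A ident_in_hom by blast
  have eqs: "Dom C m = X" "Dom C (Ident C A) = A" "Cod C (Ident C A) = A" using m idA by (simp_all add: hom_def)
  have mb: "m \<cdot> b \<in> hom C A A" using b m comp_in_hom by blast
  have "(m \<cdot> b) \<cdot> m = m"
    using m b terminal_eqI[OF X comp_in_hom[OF m b] ident_in_hom] hom_objs(1)[OF m] comp_ident_right[OF m]
    by (simp add: comp_assoc[OF m b m])
  have "is_equalizer C (Ident C A) (m \<cdot> b) m"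
    unfolding is_equalizer_def eqs
  proof (intro conjI allI impI)
    show "Ident C A \<in> Ar C" "m \<cdot> b \<in> hom C A A" "m \<in> hom C X A" using idA mb m by (simp_all add: hom_def)
    show "Ident C A \<cdot> m = (m \<cdot> b) \<cdot> m" using \<open>(m \<cdot> b) \<cdot> m = m\<close> m by (simp add: comp_ident_left)
  next
    fix Z a assume a: "a \<in> hom C Z A \<and> Ident C A \<cdot> a = (m \<cdot> b) \<cdot> a"
    then have "m \<cdot> (b \<cdot> a) = a" "b \<cdot> a \<in> hom C Z X"
      using b m comp_in_hom comp_assoc[of a Z A b X m A] by (auto simp: comp_ident_left)
    then show "\<exists>!h. h \<in> hom C Z X \<and> m \<cdot> h = a" using terminal_eqI[OF X] by metis
  qed
  then show ?thesis by (auto simp: regular_monos_def)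
qed

end

context quasitopos
begin

text \<open>An arrow into the partial product of \<open>tr\<close> and \<open>B\<close> consists of
  a characteristic map and an arrow from the subobject it describes to \<open>B\<close>, hence of a
  partial map. The unit \<open>\<eta>\<close> is the arrow that codes the total map
  \<open>1 : B \<rightarrow> B\<close>.\<close>

lemma partial_map_classifier_object:
  assumes B: "B \<in> Ob C"
  shows "\<exists>E \<eta>. \<eta> \<in> hom C B E \<and> \<eta> \<in> regular_monos C \<and>
    (\<forall>m\<in>regular_monos C. \<forall>f\<in>hom C (Dom C m) B. \<exists>!h. h \<in> hom C (Cod C m) E \<and> is_pullback C h \<eta> m f)"
proof -
  obtain one \<Omega> tr where one: "is_terminal C one" and tr: "tr \<in> hom C one \<Omega>"
    and char: "\<And>m. m \<in> regular_monos C \<Longrightarrow> \<exists>!\<chi>. \<chi> \<in> hom C (Cod C m) \<Omega> \<and> (\<exists>b\<in>hom C (Dom C m) one. is_pullback C \<chi> tr m b)"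
    using regular_subobject_classifier unfolding is_regular_subobject_classifier_def by blast
  obtain E P e p q ev where u: "e \<in> hom C E \<Omega>" "p \<in> hom C P E" "q \<in> hom C P one" "ev \<in> hom C P B"
    and pp: "is_partial_product tr B e p q ev"
    by (rule partial_product_exists[OF tr B])
  have pe: "is_pullback C e tr p q" using pp by (simp add: is_partial_product_def)
  have P: "P \<in> Ob C" using u hom_objs by blast
  \<comment> \<open>A map that factors through \<open>tr\<close> describes the whole of its domain,
    so its partial maps are total.\<close>
  have pid: "is_pullback C (tr \<cdot> b) tr (Ident C Y) b" if b: "b \<in> hom C Y one" for b Y
  proof (rule pullbackI[OF comp_in_hom[OF b tr] tr _ b])
    show id: "Ident C Y \<in> hom C Y Y" using b hom_objs ident_in_hom by blast
    show "(tr \<cdot> b) \<cdot> Ident C Y = tr \<cdot> b" using b tr comp_in_hom comp_ident_right by blast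
    show "\<exists>h\<in>hom C Z Y. Ident C Y \<cdot> h = a \<and> b \<cdot> h = c" if "a \<in> hom C Z Y" "c \<in> hom C Z one" for Z a c
      using that b comp_ident_left terminal_eqI[OF one _ that(2)] comp_in_hom by metis
  qed (simp add: comp_ident_left)
  obtain b where b: "b \<in> hom C B one" using terminal_morphism[OF one B] .
  have idB: "Ident C B \<in> hom C B B" using B ident_in_hom by blast
  have trb: "tr \<cdot> b \<in> hom C B \<Omega>" using b tr comp_in_hom by blast
  obtain \<eta> k where \<eta>: "\<eta> \<in> hom C B E" "e \<cdot> \<eta> = tr \<cdot> b" and k: "k \<in> hom C B P" "p \<cdot> k = \<eta> \<cdot> Ident C B" "q \<cdot> k = b" "ev \<cdot> k = Ident C B"
    using partial_product_transpose[OF pp u(1,2) pid[OF b] trb idB idB] .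
  have pk: "p \<cdot> k = \<eta>" using k \<eta> comp_ident_right by simp
  \<comment> \<open>Both sides have transpose \<open>ev\<close>. Together with
    \<open>ev \<cdot> k = 1\<close> this identifies \<open>P\<close> with \<open>B\<close> and
    \<open>p\<close> with \<open>\<eta>\<close>, so \<open>\<eta>\<close> is a pullback of
    \<open>tr\<close>.\<close>
  have p: "p = \<eta> \<cdot> ev"
  proof (rule partial_product_unique[OF pp u(1,2) pid[OF u(3)] comp_in_hom[OF u(3) tr], of P _ "Ident C P" _ "k \<cdot> ev"])
    show "Ident C P \<in> hom C P P" "Ident C P \<in> hom C P P" "k \<cdot> ev \<in> hom C P P" "p \<in> hom C P E" "\<eta> \<cdot> ev \<in> hom C P E"
      using u k \<eta> P ident_in_hom comp_in_hom by blast+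
    show "e \<cdot> p = tr \<cdot> q" using pullback_commutes[OF pe] .
    show "p \<cdot> Ident C P = p \<cdot> Ident C P" ..
    show "q \<cdot> Ident C P = q" using u comp_ident_right by blast
    have "b \<cdot> ev = q" using terminal_eqI[OF one comp_in_hom[OF u(4) b] u(3)] .
    then show "e \<cdot> (\<eta> \<cdot> ev) = tr \<cdot> q" "q \<cdot> (k \<cdot> ev) = q"
      using u \<eta> k b tr by (simp_all add: cat_simps comp_extend[OF \<eta>(2)] comp_extend[OF k(3)])
    show "p \<cdot> (k \<cdot> ev) = (\<eta> \<cdot> ev) \<cdot> Ident C P" "ev \<cdot> Ident C P = ev \<cdot> (k \<cdot> ev)"
      using u \<eta> k P by (simp_all add: cat_simps comp_extend[OF pk] comp_extend[OF k(4)] comp_ident_arr)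
  qed
  have pb: "is_pullback C e tr \<eta> b"
  proof (rule pullbackI[OF u(1) tr \<eta>(1) b \<eta>(2)])
    fix Z a c assume ac: "a \<in> hom C Z E" "c \<in> hom C Z one" "e \<cdot> a = tr \<cdot> c"
    obtain h where h: "h \<in> hom C Z P" "p \<cdot> h = a" using pullback_lift[OF pe u(2,3) ac] .
    have "\<eta> \<cdot> (ev \<cdot> h) = a" using comp_assoc[OF h(1) u(4) \<eta>(1)] h p by simp
    moreover have "b \<cdot> (ev \<cdot> h) = c"
      using terminal_eqI[OF one comp_in_hom[OF comp_in_hom[OF h(1) u(4)] b] ac(2)] .
    ultimately show "\<exists>h\<in>hom C Z B. \<eta> \<cdot> h = a \<and> b \<cdot> h = c" using comp_in_hom[OF h(1) u(4)] by blast
  next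
    fix Z h h' assume h: "h \<in> hom C Z B" "h' \<in> hom C Z B" "\<eta> \<cdot> h = \<eta> \<cdot> h'" "b \<cdot> h = b \<cdot> h'"
    have "k \<cdot> h = k \<cdot> h'"
      by (rule pullback_eqI[OF pe u(2)])
        (use h k u in \<open>simp_all add: cat_simps comp_extend[OF pk] comp_extend[OF k(3)]\<close>)
    then have "ev \<cdot> (k \<cdot> h) = ev \<cdot> (k \<cdot> h')" by simp
    then show "h = h'" using h k u by (simp add: hom_def comp_extend[OF k(4)] comp_ident_arr)
  qed
  have \<eta>M: "\<eta> \<in> regular_monos C"
    using regular_mono_pullback[OF pb regular_mono_from_terminal[OF one tr]] .
  have "\<exists>!h. h \<in> hom C (Cod C m) E \<and> is_pullback C h \<eta> m f"
    if m: "m \<in> regular_monos C" and f: "f \<in> hom C (Dom C m) B" for m f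
  proof -
    define A X where "A = Cod C m" and "X = Dom C m"
    have t: "m \<in> hom C X A" "f \<in> hom C X B" using regular_mono_hom[OF m] f by (simp_all add: A_def X_def)
    obtain \<chi> b' where \<chi>: "\<chi> \<in> hom C A \<Omega>" "b' \<in> hom C X one" and pm: "is_pullback C \<chi> tr m b'"
      using char[OF m] unfolding A_def X_def by blast
    have b': "b' = b \<cdot> f" using terminal_eqI[OF one \<chi>(2) comp_in_hom[OF t(2) b]] .
    obtain g l where g: "g \<in> hom C A E" "e \<cdot> g = \<chi>" "l \<in> hom C X P" "p \<cdot> l = g \<cdot> m" "q \<cdot> l = b'" "ev \<cdot> l = f"
      using partial_product_transpose[OF pp u(1,2) pm \<chi>(1) t(1,2)] .
    have "g \<cdot> m = \<eta> \<cdot> f" using g(4) comp_assoc[OF g(3) u(4) \<eta>(1)] p g(6) by simp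
    then have "is_pullback C g \<eta> m f"
      using pullback_cancel[OF pb _ g(1) u(1) t(2) b] pm g(2) b' by simp
    moreover have "g1 = g" if g1: "g1 \<in> hom C A E" and pg1: "is_pullback C g1 \<eta> m f" for g1
    proof (rule partial_product_unique[OF pp u(1,2) pm \<chi>(1) t(1) _ _ _ _ _ g(1-5), of g1 "k \<cdot> f"])
      \<comment> \<open>Pasting shows that \<open>e \<cdot> g1\<close> is a characteristic map of
        \<open>m\<close>, hence \<open>\<chi>\<close>. Over \<open>\<chi>\<close> both
        \<open>g1\<close> and \<open>g\<close> have transpose \<open>f\<close>.\<close>
      have "is_pullback C (e \<cdot> g1) tr m b'" using pullback_paste[OF pb pg1] b' by simp
      then show "e \<cdot> g1 = \<chi>"
        using char[OF m] \<chi> pm comp_in_hom[OF g1 u(1)] unfolding A_def X_def by blast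
      have "g1 \<cdot> m = \<eta> \<cdot> f" using pullback_commutes[OF pg1] .
      then show "p \<cdot> (k \<cdot> f) = g1 \<cdot> m" using k t u by (simp add: hom_def comp_extend[OF pk])
      show "k \<cdot> f \<in> hom C X P" using t k comp_in_hom by blast
      show "q \<cdot> (k \<cdot> f) = b'" "ev \<cdot> (k \<cdot> f) = ev \<cdot> l"
        using k t u b' g(6) by (simp_all add: hom_def comp_extend[OF k(3)] comp_extend[OF k(4)] comp_ident_arr)
    qed (rule g1)
    ultimately show ?thesis using g(1) unfolding A_def[symmetric] by blast
  qed
  then show ?thesis using \<eta>(1) \<eta>M by blast
qed

text \<open>\<open>Tm f\<close> is the arrow that classifies the partial map
  \<open>(\<eta> A, f)\<close>. Identities and pasted squares have the defining pullback property as
  well, so functoriality follows from uniqueness.\<close>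

lemma partial_map_classifier_exists: "\<exists>T Tm \<eta>. is_partial_map_classifier C (regular_monos C) T Tm \<eta>"
proof -
  define Q where "Q B E \<eta> \<longleftrightarrow> \<eta> \<in> hom C B E \<and> \<eta> \<in> regular_monos C \<and>
    (\<forall>m\<in>regular_monos C. \<forall>f\<in>hom C (Dom C m) B. \<exists>!h. h \<in> hom C (Cod C m) E \<and> is_pullback C h \<eta> m f)" for B E \<eta>
  have "\<forall>B\<in>Ob C. \<exists>E \<eta>. Q B E \<eta>"
    using partial_map_classifier_object unfolding Q_def by blast
  from bchoice[OF this] obtain T where "\<forall>B\<in>Ob C. \<exists>\<eta>. Q B (T B) \<eta>" ..
  from bchoice[OF this] obtain \<eta> where Q: "\<forall>B\<in>Ob C. Q B (T B) (\<eta> B)" ..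
  then have \<eta>: "\<eta> B \<in> hom C B (T B)" "\<eta> B \<in> regular_monos C" if "B \<in> Ob C" for B
    using that unfolding Q_def by auto
  have ex1: "\<exists>!h. h \<in> hom C A (T B) \<and> is_pullback C h (\<eta> B) m f"
    if "m \<in> regular_monos C" "m \<in> hom C X A" "f \<in> hom C X B" for m f X A B
  proof -
    have "Dom C m = X" "Cod C m = A" using that(2) by (simp_all add: hom_def)
    then show ?thesis using that(1,3) bspec[OF Q hom_objs(2)[OF that(3)]] unfolding Q_def by blast
  qed
  have "\<exists>h. h \<in> hom C (T (Dom C f)) (T (Cod C f)) \<and> is_pullback C h (\<eta> (Cod C f)) (\<eta> (Dom C f)) f" if "f \<in> Ar C" for f
    using ex1[OF \<eta>(2,1), of "Dom C f" f "Cod C f"] that dom_in_Ob by (auto simp: hom_def[of C "Dom C f" "Cod C f"])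
  then obtain Tm where Tm: "\<And>f. f \<in> Ar C \<Longrightarrow> Tm f \<in> hom C (T (Dom C f)) (T (Cod C f)) \<and>
      is_pullback C (Tm f) (\<eta> (Cod C f)) (\<eta> (Dom C f)) f"
    by metis
  have Tm_eqI: "Tm f = h" if "f \<in> hom C A B" "h \<in> hom C (T A) (T B)" "is_pullback C h (\<eta> B) (\<eta> A) f" for f h A B
  proof -
    have f: "f \<in> Ar C" "Dom C f = A" "Cod C f = B" using that(1) by (simp_all add: hom_def)
    show ?thesis
      using Tm[OF f(1), unfolded f(2,3)] that(2,3) ex1[OF \<eta>(2,1) that(1)] hom_objs(1)[OF that(1)] by blast
  qed
  have Ob_T: "T B \<in> Ob C" if "B \<in> Ob C" for B
    using \<eta>(1)[OF that] hom_objs by blast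
  have "is_functor C C T Tm"
    unfolding is_functor_def
  proof (intro conjI ballI impI)
    show "category C" by unfold_locales
    show "category C" by unfold_locales
    show "T i \<in> Ob C" if "i \<in> Ob C" for i using Ob_T[OF that] .
    show "Tm u \<in> hom C (T (Dom C u)) (T (Cod C u))" if "u \<in> Ar C" for u using Tm[OF that] ..
    show "Tm (Ident C i) = Ident C (T i)" if i: "i \<in> Ob C" for i
      using Tm_eqI[OF ident_in_hom[OF i] ident_in_hom[OF Ob_T[OF i]] pullback_ident[OF \<eta>(1)[OF i]]] .
    fix u v assume uv: "u \<in> Ar C" "v \<in> Ar C" "Cod C u = Dom C v"
    have "is_pullback C (Tm v \<cdot> Tm u) (\<eta> (Cod C v)) (\<eta> (Dom C u)) (v \<cdot> u)"
      using pullback_paste Tm uv by metis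
    moreover have "Tm v \<cdot> Tm u \<in> hom C (T (Dom C u)) (T (Cod C v))" "v \<cdot> u \<in> hom C (Dom C u) (Cod C v)"
      using Tm[OF uv(1)] Tm[OF uv(2)] uv by (simp_all add: cat_simps)
    ultimately show "Tm (v \<cdot> u) = Tm v \<cdot> Tm u" using Tm_eqI by blast
  qed
  moreover have "Tm f \<cdot> \<eta> (Dom C f) = \<eta> (Cod C f) \<cdot> f" if "f \<in> Ar C" for f
    using Tm[OF that] pullback_commutes by blast
  moreover have "\<exists>!h. h \<in> hom C (Cod C m) (T (Cod C f)) \<and> is_pullback C h (\<eta> (Cod C f)) m f"
    if "m \<in> regular_monos C" "f \<in> Ar C" "Dom C m = Dom C f" for m f
    using ex1[OF that(1), of "Dom C m" "Cod C m" f "Cod C f"] regular_mono_hom[OF that(1)] that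
    by (simp add: hom_def[of C "Dom C f" "Cod C f"])
  ultimately show ?thesis using \<eta> unfolding is_partial_map_classifier_def by blast
qed

end

text \<open>The shape \<open>1 <- 0 -> 2\<close>. The numbers 0, 1, 2 name both the objects and
  their identities, 3 and 4 are the legs. Two legs never compose, so one factor of every composite
  is an identity and \<open>Comp\<close> returns the other.\<close>

definition span_index :: "(nat, nat) cat" where
  "span_index = \<lparr>Ob = {0, 1, 2}, Ar = {0, 1, 2, 3, 4},
     Dom = (\<lambda>u. if u \<le> 2 then u else 0),
     Cod = (\<lambda>u. if u = 3 then 1 else if u = 4 then 2 else u),
     Ident = (\<lambda>i. i), Comp = (\<lambda>v u. if v \<le> 2 then u else v)\<rparr>"

lemma finite_category_span_index: "finite_category span_index"
  unfolding finite_category_def category_def span_index_def hom_def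
  by (auto split: if_splits)

context quasitopos
begin

lemma pushout_exists:
  assumes f: "f \<in> hom C K A" and g: "g \<in> hom C K B"
  obtains P i j where "i \<in> hom C A P" "j \<in> hom C B P" "is_pushout C f g i j"
proof -
  define F where "F n = (if n = 0 then K else if n = 1 then A else B)" for n :: nat
  define Fm where "Fm n = (if n = 3 then f else if n = 4 then g else Ident C (F n))" for n :: nat
  have ob: "K \<in> Ob C" "A \<in> Ob C" "B \<in> Ob C" using f g hom_objs by blast+
  then have FO: "F n \<in> Ob C" for n by (simp add: F_def)
  have "is_functor span_index C F Fm"
    unfolding is_functor_def
  proof (intro conjI)
    show "category span_index" using finite_category_span_index by (simp add: finite_category_def)
    show "category C" by unfold_locales
    show "\<forall>i\<in>Ob span_index. F i \<in> Ob C" using FO by blast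
    show "\<forall>u\<in>Ar span_index. Fm u \<in> hom C (F (Dom span_index u)) (F (Cod span_index u))"
      using f g ob ident_in_hom by (auto simp: span_index_def Fm_def F_def)
    show "\<forall>i\<in>Ob span_index. Fm (Ident span_index i) = Ident C (F i)"
      by (auto simp: span_index_def Fm_def)
    show "\<forall>u\<in>Ar span_index. \<forall>v\<in>Ar span_index. Cod span_index u = Dom span_index v \<longrightarrow>
        Fm (v \<cdot>\<^bsub>span_index\<^esub> u) = Fm v \<cdot> Fm u"
      using f g ob comp_ident_left[OF ident_in_hom] by (auto simp: span_index_def Fm_def F_def comp_ident_left comp_ident_right)
  qed
  then obtain P c where colim: "is_colimit span_index C F Fm P c"
    using finite_colimits finite_category_span_index unfolding has_finite_colimits_def by blast
  have cocone: "is_cocone span_index C F Fm Y d \<longleftrightarrow>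
      d 0 \<in> hom C K Y \<and> d 1 \<in> hom C A Y \<and> d 2 \<in> hom C B Y \<and> d 1 \<cdot> f = d 0 \<and> d 2 \<cdot> g = d 0" for Y d
    using ob comp_ident_right hom_objs(2)
    by (auto simp: is_cocone_def span_index_def Fm_def F_def)
  have c: "c 0 \<in> hom C K P" "c 1 \<in> hom C A P" "c 2 \<in> hom C B P" "c 1 \<cdot> f = c 0" "c 2 \<cdot> g = c 0"
    using colim unfolding is_colimit_def cocone by auto
  have desc: "\<exists>!h. h \<in> hom C P Y \<and> h \<cdot> c 0 = d 0 \<and> h \<cdot> c 1 = d 1 \<and> h \<cdot> c 2 = d 2"
    if "is_cocone span_index C F Fm Y d" for Y d
  proof -
    have "\<exists>!h. h \<in> hom C P Y \<and> (\<forall>i\<in>Ob span_index. h \<cdot> c i = d i)"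
      using colim that unfolding is_colimit_def by blast
    then show ?thesis by (simp add: span_index_def)
  qed
  have "is_pushout C f g (c 1) (c 2)"
  proof (rule pushoutI[OF f g c(2,3)])
    show "c 1 \<cdot> f = c 2 \<cdot> g" using c by simp
  next
    fix Z a b assume ab: "a \<in> hom C A Z" "b \<in> hom C B Z" "a \<cdot> f = b \<cdot> g"
    define d where "d n = (if n = 0 then a \<cdot> f else if n = 1 then a else b)" for n :: nat
    have "is_cocone span_index C F Fm Z d"
      using ab comp_in_hom[OF f ab(1)] unfolding cocone d_def by simp
    from desc[OF this] show "\<exists>h\<in>hom C P Z. h \<cdot> c 1 = a \<and> h \<cdot> c 2 = b" by (auto simp: d_def)
  next
    fix Z h h' assume h: "h \<in> hom C P Z" "h' \<in> hom C P Z" "h \<cdot> c 1 = h' \<cdot> c 1" "h \<cdot> c 2 = h' \<cdot> c 2"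
    have h0: "h \<cdot> c 0 = (h \<cdot> c 1) \<cdot> f" "h' \<cdot> c 0 = (h' \<cdot> c 1) \<cdot> f" "h \<cdot> c 0 = (h \<cdot> c 2) \<cdot> g"
      "h' \<cdot> c 0 = (h' \<cdot> c 2) \<cdot> g"
      using comp_assoc[OF f c(2) h(1)] comp_assoc[OF f c(2) h(2)] comp_assoc[OF g c(3) h(1)]
        comp_assoc[OF g c(3) h(2)] c(4,5) by simp_all
    have "is_cocone span_index C F Fm Z (\<lambda>n. h \<cdot> c n)"
      using comp_in_hom[OF c(1) h(1)] comp_in_hom[OF c(2) h(1)] comp_in_hom[OF c(3) h(1)] h0(1,3)
      unfolding cocone by simp
    from desc[OF this] show "h = h'" using h h0 by metis
  qed
  with c that show thesis by blast
qed

end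

section \<open>Comparing the formalisms\<close>

text \<open>The pullback condition on the match already forces \<open>g\<^sub>L \<cdot> u = m \<cdot> l\<close>, so uniqueness of \<open>u\<close> is automatic.\<close>

lemma (in category) pbpo_plus_step_iff:
  assumes t: "l \<in> hom C K L" "t\<^sub>L \<in> hom C L L'" "t\<^sub>K \<in> hom C K K'" "l' \<in> hom C K' L'" and c: "t\<^sub>L \<cdot> l = l' \<cdot> t\<^sub>K"
  shows "pbpo_plus_step C (PBPO_Plus_Rule l r t\<^sub>L t\<^sub>K l') m \<alpha> G H \<longleftrightarrow>
    m \<in> hom C L G \<and> \<alpha> \<in> hom C G L' \<and> \<alpha> \<cdot> m = t\<^sub>L \<and> is_pullback C t\<^sub>L \<alpha> (Ident C L) m \<and>
    (\<exists>G\<^sub>K u g\<^sub>L u' g\<^sub>R w.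
      u \<in> hom C K G\<^sub>K \<and> g\<^sub>L \<in> hom C G\<^sub>K G \<and> g\<^sub>R \<in> hom C G\<^sub>K H \<and>
      is_pullback C \<alpha> l' g\<^sub>L u' \<and> g\<^sub>L \<cdot> u = m \<cdot> l \<and> u' \<cdot> u = t\<^sub>K \<and> is_pushout C u r g\<^sub>R w)"
proof -
  have eqs: "Dom C l = K" "Cod C l = L" "Cod C t\<^sub>L = L'" using t by (simp_all add: hom_def)
  have "u' \<cdot> u = t\<^sub>K \<and> (\<forall>v\<in>hom C K G\<^sub>K. u' \<cdot> v = t\<^sub>K \<longrightarrow> v = u) \<longleftrightarrow> g\<^sub>L \<cdot> u = m \<cdot> l \<and> u' \<cdot> u = t\<^sub>K"
    if m: "m \<in> hom C L G" and \<alpha>: "\<alpha> \<in> hom C G L'" and pm: "is_pullback C t\<^sub>L \<alpha> (Ident C L) m"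
      and u: "u \<in> hom C K G\<^sub>K" and g: "g\<^sub>L \<in> hom C G\<^sub>K G" and pb: "is_pullback C \<alpha> l' g\<^sub>L u'" for G\<^sub>K u g\<^sub>L u'
  proof -
    have u': "u' \<in> hom C G\<^sub>K K'"
      using pullback_homs(2)[OF pullback_sym[OF pb] t(4) g] .
    have id: "Ident C L \<in> hom C L L" using t(1) hom_objs ident_in_hom by blast
    have *: "g\<^sub>L \<cdot> v = m \<cdot> l" if v: "v \<in> hom C K G\<^sub>K" "u' \<cdot> v = t\<^sub>K" for v
    proof -
      have "t\<^sub>L \<cdot> l = \<alpha> \<cdot> (g\<^sub>L \<cdot> v)"
        using v c t \<alpha> g u' by (simp add: hom_def comp_extend[OF pullback_commutes[OF pb]] comp_assoc_arr)
      then obtain k where "k \<in> hom C K L" "Ident C L \<cdot> k = l" "m \<cdot> k = g\<^sub>L \<cdot> v"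
        using pullback_lift[OF pm id m t(1) comp_in_hom[OF v(1) g]] by blast
      then show ?thesis by (simp add: comp_ident_left)
    qed
    show ?thesis using * u pullback_eqI[OF pb g _ u] by metis
  qed
  then show ?thesis unfolding pbpo_plus_step.simps eqs by (smt (verit, best))
qed

section \<open>Classifying arrows; AGREE and SqPO\<close>

locale classified_quasitopos = quasitopos C for C :: "('o, 'a) cat" (structure) +
  fixes T :: "'o \<Rightarrow> 'o" and Tm :: "'a \<Rightarrow> 'a" and \<eta> :: "'o \<Rightarrow> 'a"
  assumes classifier: "is_partial_map_classifier C (regular_monos C) T Tm \<eta>"
begin

abbreviation cls :: "'a \<Rightarrow> 'a \<Rightarrow> 'a" where "cls \<equiv> classify C T \<eta>"

lemma unit_hom: "B \<in> Ob C \<Longrightarrow> \<eta> B \<in> hom C B (T B)"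
  and unit_regular_mono: "B \<in> Ob C \<Longrightarrow> \<eta> B \<in> regular_monos C"
  using classifier unfolding is_partial_map_classifier_def by blast+

lemma classify_ex1:
  assumes m: "m \<in> regular_monos C" "m \<in> hom C X A" and f: "f \<in> hom C X B"
  shows "\<exists>!h. h \<in> hom C A (T B) \<and> is_pullback C h (\<eta> B) m f"
proof -
  have eqs: "Dom C m = X" "Cod C m = A" "Dom C f = X" "Cod C f = B" using m f by (simp_all add: hom_def)
  have "\<exists>!h. h \<in> hom C (Cod C m) (T (Cod C f)) \<and> is_pullback C h (\<eta> (Cod C f)) m f"
    using classifier m(1) f eqs unfolding is_partial_map_classifier_def hom_def by blast
  then show ?thesis unfolding eqs .
qed

lemma classify:
  assumes "m \<in> regular_monos C" "m \<in> hom C X A" "f \<in> hom C X B"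
  shows classify_hom: "cls m f \<in> hom C A (T B)"
    and classify_pullback: "is_pullback C (cls m f) (\<eta> B) m f"
proof -
  have "Cod C m = A" "Cod C f = B" using assms by (simp_all add: hom_def)
  then show "cls m f \<in> hom C A (T B)" "is_pullback C (cls m f) (\<eta> B) m f"
    using theI'[OF classify_ex1[OF assms]] by (simp_all add: classify_def)
qed

text \<open>A pullback of the unit is itself a regular mono, so the square alone shows that
  \<open>(m, f)\<close> is a partial map with classifying arrow \<open>h\<close>.\<close>

lemma classify_eqI:
  assumes h: "h \<in> hom C A (T B)" and pb: "is_pullback C h (\<eta> B) m f" and f: "f \<in> hom C X B"
  shows "cls m f = h"
proof -
  have "m \<in> regular_monos C"
    using regular_mono_pullback[OF pb unit_regular_mono] hom_objs[OF f] by blast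
  moreover have "m \<in> hom C X A" using pullback_homs(2)[OF pb h f] .
  ultimately show ?thesis using classify[OF _ _ f] classify_ex1[OF _ _ f] h pb by metis
qed

lemma pushout_regular_mono:
  assumes po: "is_pushout C l f i j" and l: "l \<in> regular_monos C" "l \<in> hom C K L" and f: "f \<in> hom C K A"
    and ij: "i \<in> hom C L P" "j \<in> hom C A P"
  shows pushout_regular_mono_pullback: "is_pullback C i j l f"
    and pushout_regular_mono_eqI:
      "\<And>Z h h'. h \<in> hom C Z A \<Longrightarrow> h' \<in> hom C Z A \<Longrightarrow> j \<cdot> h = j \<cdot> h' \<Longrightarrow> h = h'"
proof -
  have A: "A \<in> Ob C" using f hom_objs by blast
  note c = classify[OF l f] and \<eta> = unit_hom[OF A]
  \<comment> \<open>Composing with \<open>d\<close> turns a cone over \<open>(i, j)\<close> into a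
    cone over the classifying pullback of \<open>(l, f)\<close>, and
    \<open>d \<cdot> j = \<eta> A\<close> makes \<open>j\<close> monic.\<close>
  obtain d where d: "d \<in> hom C P (T A)" "d \<cdot> i = cls l f" "d \<cdot> j = \<eta> A"
    using pushout_desc[OF po ij c(1) \<eta>] pullback_commutes[OF c(2)] by blast
  show j: "h = h'" if h: "h \<in> hom C Z A" "h' \<in> hom C Z A" "j \<cdot> h = j \<cdot> h'" for Z h h'
  proof (rule regular_mono_eqI[OF unit_regular_mono[OF A] \<eta> h(1,2)])
    show "\<eta> A \<cdot> h = \<eta> A \<cdot> h'"
      using comp_assoc[OF h(1) ij(2) d(1)] comp_assoc[OF h(2) ij(2) d(1)] h(3) d(3) by simp
  qed
  show "is_pullback C i j l f"
  proof (rule pullbackI[OF ij l(2) f pushout_commutes[OF po]])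
    fix Z a b assume ab: "a \<in> hom C Z L" "b \<in> hom C Z A" "i \<cdot> a = j \<cdot> b"
    have "cls l f \<cdot> a = \<eta> A \<cdot> b"
      using comp_assoc[OF ab(1) ij(1) d(1)] comp_assoc[OF ab(2) ij(2) d(1)] ab(3) d by simp
    then show "\<exists>h\<in>hom C Z K. l \<cdot> h = a \<and> f \<cdot> h = b"
      using pullback_lift[OF c(2) l(2) f ab(1,2)] by blast
  qed (use regular_mono_eqI[OF l] in blast)
qed

lemma AGREE_modeled_by_PBPO_plus: "AGREE C (regular_monos C) T \<eta> \<prec> PBPO_plus C (regular_monos C)"
  unfolding modeled_by_def
proof
  fix \<rho> assume "\<rho> \<in> rules (AGREE C (regular_monos C) T \<eta>)"
  then obtain l r t\<^sub>K K L R K' where \<rho>: "\<rho> = AGREE_Rule l r t\<^sub>K" and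
    t: "l \<in> hom C K L" "r \<in> hom C K R" "t\<^sub>K \<in> hom C K K'" "t\<^sub>K \<in> regular_monos C"
    by (cases \<rho>) (auto simp: AGREE_def)
  have L: "L \<in> Ob C" using t hom_objs by blast
  have id: "Ident C L \<in> hom C L L" using L ident_in_hom by blast
  note \<eta> = unit_hom[OF L] and l' = classify[OF t(4,3,1)]
  note pb = pullback_sym[OF l'(2)]
  define \<tau> where "\<tau> = PBPO_Plus_Rule l r (\<eta> L) t\<^sub>K (cls t\<^sub>K l)"
  have "\<tau> \<in> rules (PBPO_plus C (regular_monos C))"
    unfolding \<tau>_def PBPO_plus_def using t \<eta> l'(1) pb by auto
  moreover have "agree_step C T \<eta> \<rho> m G H \<longleftrightarrow> (\<exists>\<alpha>. pbpo_plus_step C \<tau> m \<alpha> G H)" if m: "m \<in> regular_monos C" for m G H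
  proof -
    have eqs: "Dom C l = K" "Cod C l = L" using t by (simp_all add: hom_def)
    have \<alpha>: "\<alpha> \<in> hom C G (T L) \<and> \<alpha> \<cdot> m = \<eta> L \<and> is_pullback C (\<eta> L) \<alpha> (Ident C L) m \<longleftrightarrow> \<alpha> = cls m (Ident C L)"
      if "m \<in> hom C L G" for \<alpha>
    proof
      assume "\<alpha> \<in> hom C G (T L) \<and> \<alpha> \<cdot> m = \<eta> L \<and> is_pullback C (\<eta> L) \<alpha> (Ident C L) m"
      then show "\<alpha> = cls m (Ident C L)" using classify_eqI[OF _ pullback_sym id] by metis
    next
      assume \<alpha>: "\<alpha> = cls m (Ident C L)"
      note c = classify[OF m that id, folded \<alpha>]
      show "\<alpha> \<in> hom C G (T L) \<and> \<alpha> \<cdot> m = \<eta> L \<and> is_pullback C (\<eta> L) \<alpha> (Ident C L) m"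
        using c pullback_sym pullback_commutes[OF c(2)] comp_ident_right[OF \<eta>] by simp
    qed
    \<comment> \<open>Once the adherence is fixed, both kinds of step ask for the same remaining
      data.\<close>
    define S where "S \<alpha> \<longleftrightarrow> (\<exists>G\<^sub>K u g\<^sub>L u' g\<^sub>R w.
      u \<in> hom C K G\<^sub>K \<and> g\<^sub>L \<in> hom C G\<^sub>K G \<and> g\<^sub>R \<in> hom C G\<^sub>K H \<and>
      is_pullback C \<alpha> (cls t\<^sub>K l) g\<^sub>L u' \<and> g\<^sub>L \<cdot> u = m \<cdot> l \<and> u' \<cdot> u = t\<^sub>K \<and> is_pushout C u r g\<^sub>R w)" for \<alpha>
    have "agree_step C T \<eta> \<rho> m G H \<longleftrightarrow> m \<in> hom C L G \<and> S (cls m (Ident C L))"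
      unfolding \<rho> agree_step.simps eqs S_def by (rule refl)
    moreover have "pbpo_plus_step C \<tau> m \<alpha> G H \<longleftrightarrow> m \<in> hom C L G \<and>
        (\<alpha> \<in> hom C G (T L) \<and> \<alpha> \<cdot> m = \<eta> L \<and> is_pullback C (\<eta> L) \<alpha> (Ident C L) m) \<and> S \<alpha>" for \<alpha>
      unfolding \<tau>_def pbpo_plus_step_iff[OF t(1) \<eta> t(3) l'(1) pullback_commutes[OF pb]] S_def by simp
    ultimately show ?thesis using \<alpha> by metis
  qed
  ultimately show "\<exists>\<tau>\<in>rules (PBPO_plus C (regular_monos C)).
      rewrites_to (AGREE C (regular_monos C) T \<eta>) \<rho> = rewrites_to (PBPO_plus C (regular_monos C)) \<tau>"
    by (intro bexI[of _ \<tau>] ext) (auto simp: AGREE_def PBPO_plus_def)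
qed

text \<open>A cone over \<open>[m, 1]\<close> and \<open>[\<eta> K, l]\<close> is a pair
  \<open>(a, b)\<close>. Here \<open>b\<close> codes a partial map \<open>(c, f)\<close> into
  \<open>K\<close>, and commutation says that \<open>(c, l \<cdot> f)\<close> is the pullback of
  \<open>m\<close> along \<open>a\<close>. These are the test data in the definition of a final
  pullback complement, so the two universal properties coincide.\<close>

lemma final_pullback_complement_iff_pullback:
  assumes t: "l \<in> hom C K L" "m \<in> hom C L G" "u \<in> hom C K G\<^sub>K" "g \<in> hom C G\<^sub>K G" and m: "m \<in> regular_monos C"
    and pb: "is_pullback C g m u l" and u': "u' \<in> hom C G\<^sub>K (T K)" and pu: "is_pullback C u' (\<eta> K) u (Ident C K)"
  shows "is_final_pullback_complement C l m u g \<longleftrightarrow>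
    is_pullback C (cls m (Ident C L)) (cls (\<eta> K) l) g u'"
proof -
  have ob: "K \<in> Ob C" "L \<in> Ob C" using t hom_objs by blast+
  note \<eta> = unit_hom[OF ob(1)] and \<eta>L = unit_hom[OF ob(2)]
  note idK = ident_in_hom[OF ob(1)] and idL = ident_in_hom[OF ob(2)]
  define \<alpha> \<kappa> where "\<alpha> = cls m (Ident C L)" and "\<kappa> = cls (\<eta> K) l"
  note \<alpha> = classify[OF m t(2) idL, folded \<alpha>_def]
  note \<kappa> = classify[OF unit_regular_mono[OF ob(1)] \<eta> t(1), folded \<kappa>_def]
  have ul: "cls u l = \<kappa> \<cdot> u'"
    using classify_eqI[OF comp_in_hom[OF u' \<kappa>(1)], of u l] pullback_paste[OF \<kappa>(2) pu] comp_ident_right[OF t(1)] t(1)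
    by simp
  \<comment> \<open>\<open>[m, 1] \<cdot> d\<close> classifies the pullback of \<open>m\<close>
    along \<open>d\<close>.\<close>
  have lifted: "cls c a = \<alpha> \<cdot> d" if "is_pullback C d m c a" "d \<in> hom C Z G" "a \<in> hom C X L" for a c d X Z
    using classify_eqI[OF comp_in_hom[OF that(2) \<alpha>(1)], of c a] pullback_paste[OF \<alpha>(2) that(1)] comp_ident_left[OF that(3)] that(3)
    by simp
  have sq: "\<alpha> \<cdot> g = \<kappa> \<cdot> u'" using lifted[OF pb t(4,1)] ul by simp
  have u'u: "u' \<cdot> u = \<eta> K" using pullback_commutes[OF pu] comp_ident_right[OF \<eta>] by simp
  have eqs: "Dom C l = K" "Dom C g = G\<^sub>K" using t by (simp_all add: hom_def)
  text \<open>Both directions identify arrows into \<open>T K\<close> with the partial maps they classify.\<close>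
  have transpose: "cls c f = u' \<cdot> h"
    if "is_pullback C (g \<cdot> h) m c (l \<cdot> f)" "h \<in> hom C Z G\<^sub>K" "f \<in> hom C X K" "h \<cdot> c = u \<cdot> f" for c f h X Z
  proof (rule classify_eqI[OF comp_in_hom[OF that(2) u'] _ that(3)])
    have "is_pullback C h u c f" using pullback_cancel[OF pb that(1,2) t(4) that(3) t(1) that(4)] .
    from pullback_paste[OF pu this] show "is_pullback C (u' \<cdot> h) (\<eta> K) c f" using comp_ident_left[OF that(3)] by simp
  qed
  \<comment> \<open>A cone over \<open>(\<alpha>, \<kappa>)\<close> yields a test square for
    finality: \<open>b\<close> is decoded by pulling back \<open>\<eta> K\<close>.\<close>
  have partial: "\<exists>X c f. c \<in> hom C X Z \<and> f \<in> hom C X K \<and> is_pullback C b (\<eta> K) c f \<and> is_pullback C a m c (l \<cdot> f)"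
    if ab: "a \<in> hom C Z G" "b \<in> hom C Z (T K)" "\<alpha> \<cdot> a = \<kappa> \<cdot> b" for Z a b
  proof -
    obtain X c f where c: "c \<in> hom C X Z" "f \<in> hom C X K" and pc: "is_pullback C b (\<eta> K) c f"
      using pullback_exists[OF ab(2) \<eta>] .
    have lf: "l \<cdot> f \<in> hom C X L" using c t comp_in_hom by blast
    have pa: "is_pullback C (\<alpha> \<cdot> a) (\<eta> L) c (l \<cdot> f)" using pullback_paste[OF \<kappa>(2) pc] ab(3) by simp
    have "\<alpha> \<cdot> (a \<cdot> c) = \<eta> L \<cdot> (l \<cdot> f)" using pullback_commutes[OF pa] comp_assoc[OF c(1) ab(1) \<alpha>(1)] by simp
    then obtain k where "k \<in> hom C X L" "m \<cdot> k = a \<cdot> c" "Ident C L \<cdot> k = l \<cdot> f"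
      using pullback_lift[OF \<alpha>(2) t(2) idL comp_in_hom[OF c(1) ab(1)] lf] by blast
    then have "a \<cdot> c = m \<cdot> (l \<cdot> f)" by (simp add: comp_ident_left)
    then have "is_pullback C a m c (l \<cdot> f)"
      using pullback_cancel[OF \<alpha>(2) _ ab(1) \<alpha>(1) lf idL] pa comp_ident_left[OF lf] by simp
    with c pc show ?thesis by blast
  qed
  show ?thesis
    unfolding \<alpha>_def[symmetric] \<kappa>_def[symmetric]
  proof
    assume fpc: "is_final_pullback_complement C l m u g"
    have final: "\<exists>!h. h \<in> hom C Z G\<^sub>K \<and> g \<cdot> h = a \<and> h \<cdot> c = u \<cdot> f"
      if "is_pullback C a m c (l \<cdot> f)" "a \<in> hom C Z G" "f \<in> hom C X K" for a c f X Z
    proof -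
      have "Dom C (l \<cdot> f) = X" "Dom C a = Z" using that t by (simp_all add: cat_simps)
      then show ?thesis
        using fpc pullback_sym[OF that(1)] that(3) unfolding is_final_pullback_complement_def eqs by metis
    qed
    show "is_pullback C \<alpha> \<kappa> g u'"
    proof (rule pullbackI[OF \<alpha>(1) \<kappa>(1) t(4) u' sq])
      fix Z a b assume ab: "a \<in> hom C Z G" "b \<in> hom C Z (T K)" "\<alpha> \<cdot> a = \<kappa> \<cdot> b"
      obtain X c f where c: "c \<in> hom C X Z" "f \<in> hom C X K" "is_pullback C b (\<eta> K) c f" "is_pullback C a m c (l \<cdot> f)"
        using partial[OF ab] by blast
      obtain h where h: "h \<in> hom C Z G\<^sub>K" "g \<cdot> h = a" "h \<cdot> c = u \<cdot> f"
        using final[OF c(4) ab(1) c(2)] by blast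
      have "u' \<cdot> h = b"
        using transpose[of h c f, OF _ h(1) c(2) h(3)] h(2) c(4) classify_eqI[OF ab(2) c(3,2)] by simp
      with h show "\<exists>h\<in>hom C Z G\<^sub>K. g \<cdot> h = a \<and> u' \<cdot> h = b" by blast
    next
      fix Z h h' assume h: "h \<in> hom C Z G\<^sub>K" "h' \<in> hom C Z G\<^sub>K" "g \<cdot> h = g \<cdot> h'" "u' \<cdot> h = u' \<cdot> h'"
      have gh: "g \<cdot> h \<in> hom C Z G" and uh: "u' \<cdot> h \<in> hom C Z (T K)" using h t u' comp_in_hom by blast+
      have "\<alpha> \<cdot> (g \<cdot> h) = \<kappa> \<cdot> (u' \<cdot> h)" by (rule comp_commute[OF sq t(4) \<alpha>(1) u' \<kappa>(1) h(1)])
      then obtain X c f where c: "c \<in> hom C X Z" "f \<in> hom C X K" and pc: "is_pullback C (u' \<cdot> h) (\<eta> K) c f"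
        and pa: "is_pullback C (g \<cdot> h) m c (l \<cdot> f)"
        using partial[OF gh uh] by blast
      \<comment> \<open>This holds for \<open>h\<close> and for \<open>h'\<close>, so both solve the
        same factorization problem and finality identifies them.\<close>
      have "k \<cdot> c = u \<cdot> f" if k: "k \<in> hom C Z G\<^sub>K" "u' \<cdot> k = u' \<cdot> h" for k
      proof -
        have "u' \<cdot> (k \<cdot> c) = \<eta> K \<cdot> f"
          using pullback_commutes[OF pc] comp_assoc[OF c(1) k(1) u'] k(2) by simp
        then obtain x where "x \<in> hom C X K" "u \<cdot> x = k \<cdot> c" "Ident C K \<cdot> x = f"
          using pullback_lift[OF pu t(3) idK comp_in_hom[OF c(1) k(1)] c(2)] by blast
        then show ?thesis by (simp add: comp_ident_left)
      qed
      then show "h = h'" using final[OF pa gh c(2)] h by metis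
    qed
  next
    assume pb': "is_pullback C \<alpha> \<kappa> g u'"
    show "is_final_pullback_complement C l m u g"
      unfolding is_final_pullback_complement_def eqs
    proof (intro conjI allI impI)
      fix a c d f assume asm: "is_pullback C m d a c \<and> f \<in> hom C (Dom C a) K \<and> l \<cdot> f = a"
      define X Z where "X = Dom C a" and "Z = Dom C d"
      have a: "a = l \<cdot> f" and f: "f \<in> hom C X K" and pd: "is_pullback C d m c a"
        using asm pullback_sym by (auto simp: X_def)
      have ta: "a \<in> hom C X L" using f t a comp_in_hom by blast
      have d: "d \<in> hom C Z G" using asm t(2) by (simp add: is_pullback_def hom_def Z_def)
      have c: "c \<in> hom C X Z" using pullback_homs(2)[OF pd d ta] .
      have cM: "c \<in> regular_monos C" using regular_mono_pullback[OF pd m] .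
      \<comment> \<open>The factorization \<open>f\<close> of \<open>a\<close> through
        \<open>l\<close>, coded as an arrow into \<open>T K\<close>, is the second component of a
        cone over \<open>(\<alpha>, \<kappa>)\<close>.\<close>
      define b where "b = cls c f"
      note b = classify[OF cM c f, folded b_def]
      have "cls c a = \<kappa> \<cdot> b"
        using classify_eqI[OF comp_in_hom[OF b(1) \<kappa>(1)] pullback_paste[OF \<kappa>(2) b(2)]] ta a by simp
      then have "\<alpha> \<cdot> d = \<kappa> \<cdot> b" using lifted[OF pd d ta] by simp
      then obtain h where h: "h \<in> hom C Z G\<^sub>K" "g \<cdot> h = d" "u' \<cdot> h = b"
        using pullback_lift[OF pb' t(4) u' d b(1)] by blast
      have "h \<cdot> c = u \<cdot> f"
      proof (rule pullback_eqI[OF pb' t(4)])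
        show "h \<cdot> c \<in> hom C X G\<^sub>K" "u \<cdot> f \<in> hom C X G\<^sub>K" using h c f t comp_in_hom by blast+
        show "g \<cdot> (h \<cdot> c) = g \<cdot> (u \<cdot> f)"
          using h c f t pullback_commutes[OF pd]
          by (simp add: hom_def comp_extend[OF h(2)] comp_extend[OF pullback_commutes[OF pb]] a comp_assoc_arr)
        show "u' \<cdot> (h \<cdot> c) = u' \<cdot> (u \<cdot> f)"
          using h c f t u' pullback_commutes[OF b(2)] by (simp add: hom_def comp_extend[OF h(3)] comp_extend[OF u'u])
      qed
      moreover have "h' = h" if h': "h' \<in> hom C Z G\<^sub>K" "g \<cdot> h' = d" "h' \<cdot> c = u \<cdot> f" for h'
      proof -
        have "is_pullback C (g \<cdot> h') m c (l \<cdot> f)" using pd unfolding h'(2) a .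
        from transpose[OF this h'(1) f h'(3)] have "u' \<cdot> h' = b" unfolding b_def by (rule sym)
        then show ?thesis using pullback_eqI[OF pb' t(4) h'(1) h(1)] h'(2) h(2,3) by simp
      qed
      ultimately show "\<exists>!h. h \<in> hom C (Dom C d) G\<^sub>K \<and> g \<cdot> h = d \<and> h \<cdot> c = u \<cdot> f"
        using h unfolding Z_def by blast
    qed (rule pb)
  qed
qed

text \<open>An AGREE step asks only that \<open>u\<close> commute with the two projections.
  Cancelling the square of \<open>\<alpha>\<close> and \<open>\<kappa>\<close> makes
  \<open>(u, l)\<close> a pullback of \<open>(g, m)\<close>; cancelling the classifying square of
  \<open>\<kappa>\<close> then forces \<open>u' = [u, 1]\<close>.\<close>

lemma final_pullback_complement_iff:
  assumes t: "l \<in> hom C K L" "m \<in> hom C L G" "u \<in> hom C K G\<^sub>K" "g \<in> hom C G\<^sub>K G" and m: "m \<in> regular_monos C"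
  shows "is_final_pullback_complement C l m u g \<longleftrightarrow>
    (\<exists>u'. is_pullback C (cls m (Ident C L)) (cls (\<eta> K) l) g u' \<and> g \<cdot> u = m \<cdot> l \<and> u' \<cdot> u = \<eta> K)"
proof -
  have ob: "K \<in> Ob C" "L \<in> Ob C" using t hom_objs by blast+
  note \<eta> = unit_hom[OF ob(1)] and \<eta>L = unit_hom[OF ob(2)]
  note idK = ident_in_hom[OF ob(1)] and idL = ident_in_hom[OF ob(2)]
  define \<alpha> \<kappa> where "\<alpha> = cls m (Ident C L)" and "\<kappa> = cls (\<eta> K) l"
  note \<alpha> = classify[OF m t(2) idL, folded \<alpha>_def]
  note \<kappa> = classify[OF unit_regular_mono[OF ob(1)] \<eta> t(1), folded \<kappa>_def]
  note main = final_pullback_complement_iff_pullback[OF t m, folded \<alpha>_def \<kappa>_def]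
  show ?thesis
    unfolding \<alpha>_def[symmetric] \<kappa>_def[symmetric]
  proof
    assume fpc: "is_final_pullback_complement C l m u g"
    then have pb: "is_pullback C g m u l" by (simp add: is_final_pullback_complement_def)
    note u' = classify[OF regular_mono_pullback[OF pb m] t(3) idK]
    have "cls u (Ident C K) \<cdot> u = \<eta> K" using pullback_commutes[OF u'(2)] comp_ident_right[OF \<eta>] by simp
    then show "\<exists>u'. is_pullback C \<alpha> \<kappa> g u' \<and> g \<cdot> u = m \<cdot> l \<and> u' \<cdot> u = \<eta> K"
      using main[OF pb u'] fpc pullback_commutes[OF pb] by blast
  next
    assume "\<exists>u'. is_pullback C \<alpha> \<kappa> g u' \<and> g \<cdot> u = m \<cdot> l \<and> u' \<cdot> u = \<eta> K"
    then obtain u' where pb': "is_pullback C \<alpha> \<kappa> g u'" and c: "g \<cdot> u = m \<cdot> l" "u' \<cdot> u = \<eta> K" by blast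
    have u': "u' \<in> hom C G\<^sub>K (T K)" using pullback_homs(2)[OF pullback_sym[OF pb'] \<kappa>(1) t(4)] .
    have \<alpha>m: "\<alpha> \<cdot> m = \<eta> L" using pullback_commutes[OF \<alpha>(2)] comp_ident_right[OF \<eta>L] by simp
    have "is_pullback C (\<alpha> \<cdot> m) \<kappa> l (u' \<cdot> u)" using pullback_sym[OF \<kappa>(2)] c \<alpha>m by simp
    then have "is_pullback C m g l u" using pullback_cancel[OF pb' _ t(2) \<alpha>(1) t(3) u'] c by simp
    then have pb: "is_pullback C g m u l" by (rule pullback_sym)
    have "is_pullback C (\<kappa> \<cdot> u') (\<eta> L) u (l \<cdot> Ident C K)"
      using pullback_paste[OF \<alpha>(2) pb] pullback_commutes[OF pb'] comp_ident_left[OF t(1)] comp_ident_right[OF t(1)] by simp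
    then have "is_pullback C u' (\<eta> K) u (Ident C K)"
      using pullback_cancel[OF \<kappa>(2) _ u' \<kappa>(1) idK t(1)] c comp_ident_right[OF \<eta>] by simp
    then show "is_final_pullback_complement C l m u g" using main[OF pb u'] pb' by blast
  qed
qed

lemma SqPO_modeled_by_AGREE: "SqPO C (regular_monos C) \<prec> AGREE C (regular_monos C) T \<eta>"
  unfolding modeled_by_def
proof
  fix \<rho> assume "\<rho> \<in> rules (SqPO C (regular_monos C))"
  then obtain l r K L R where \<rho>: "\<rho> = Span_Rule l r" and t: "l \<in> hom C K L" "r \<in> hom C K R"
    by (cases \<rho>) (auto simp: SqPO_def)
  have K: "K \<in> Ob C" using t hom_objs by blast
  have eqs: "Dom C l = K" "Cod C l = L" using t by (simp_all add: hom_def)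
  define \<tau> where "\<tau> = AGREE_Rule l r (\<eta> K)"
  have "\<tau> \<in> rules (AGREE C (regular_monos C) T \<eta>)"
    unfolding \<tau>_def AGREE_def using t unit_hom[OF K] unit_regular_mono[OF K] by auto
  moreover have "sqpo_step C \<rho> m G H \<longleftrightarrow> agree_step C T \<eta> \<tau> m G H" if m: "m \<in> regular_monos C" for m G H
    unfolding \<rho> \<tau>_def sqpo_step.simps agree_step.simps eqs
    using final_pullback_complement_iff[OF t(1) _ _ _ m] by (smt (verit, best))
  ultimately show "\<exists>\<tau>\<in>rules (AGREE C (regular_monos C) T \<eta>).
      rewrites_to (SqPO C (regular_monos C)) \<rho> = rewrites_to (AGREE C (regular_monos C) T \<eta>) \<tau>"
    by (intro bexI[of _ \<tau>] ext) (auto simp: AGREE_def SqPO_def)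
qed

end

section \<open>DPO and PBPO\<close>

context quasitopos
begin

text \<open>This replaces the argument that an element of a pushout comes from one of its two sides.
  A generalized element \<open>b\<close> is split into its parts over \<open>A\<close> and
  \<open>B\<close>; by stability these glue to \<open>Z\<close>, so arrows out of \<open>Z\<close>
  can be built and compared on the parts.\<close>

lemma pushout_pullback_cover:
  assumes po: "is_pushout C f g i j"
    and t: "f \<in> hom C K A" "g \<in> hom C K B" "i \<in> hom C A X" "j \<in> hom C B X" and b: "b \<in> hom C Z X"
  obtains Z\<^sub>0 Z\<^sub>1 Z\<^sub>2 k a\<^sub>1 x\<^sub>1 a\<^sub>2 x\<^sub>2 f' g'
  where "k \<in> hom C Z\<^sub>0 K" "a\<^sub>1 \<in> hom C Z\<^sub>1 A" "x\<^sub>1 \<in> hom C Z\<^sub>1 Z" "a\<^sub>2 \<in> hom C Z\<^sub>2 B" "x\<^sub>2 \<in> hom C Z\<^sub>2 Z"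
    and "f' \<in> hom C Z\<^sub>0 Z\<^sub>1" "g' \<in> hom C Z\<^sub>0 Z\<^sub>2" "is_pushout C f' g' x\<^sub>1 x\<^sub>2"
    and "i \<cdot> a\<^sub>1 = b \<cdot> x\<^sub>1" "j \<cdot> a\<^sub>2 = b \<cdot> x\<^sub>2" "a\<^sub>1 \<cdot> f' = f \<cdot> k" "a\<^sub>2 \<cdot> g' = g \<cdot> k"
proof -
  have tif: "i \<cdot> f \<in> hom C K X" using t comp_in_hom by blast
  obtain Z1 a1 x1 where 1: "a1 \<in> hom C Z1 A" "x1 \<in> hom C Z1 Z" "is_pullback C i b a1 x1"
    using pullback_exists[OF t(3) b] .
  obtain Z2 a2 x2 where 2: "a2 \<in> hom C Z2 B" "x2 \<in> hom C Z2 Z" "is_pullback C j b a2 x2"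
    using pullback_exists[OF t(4) b] .
  obtain Z0 k k' where 0: "k \<in> hom C Z0 K" "k' \<in> hom C Z0 Z" "is_pullback C (i \<cdot> f) b k k'"
    using pullback_exists[OF tif b] .
  have "i \<cdot> (f \<cdot> k) = b \<cdot> k'"
    using pullback_commutes[OF 0(3)] comp_assoc[OF 0(1) t(1,3)] by simp
  then obtain f' where f': "f' \<in> hom C Z0 Z1" "a1 \<cdot> f' = f \<cdot> k" "x1 \<cdot> f' = k'"
    using pullback_lift[OF 1(3,1,2) comp_in_hom[OF 0(1) t(1)] 0(2)] by blast
  have "j \<cdot> (g \<cdot> k) = b \<cdot> k'"
    using pullback_commutes[OF 0(3)] pushout_commutes[OF po] comp_assoc[OF 0(1) t(2,4)] by simp
  then obtain g' where g': "g' \<in> hom C Z0 Z2" "a2 \<cdot> g' = g \<cdot> k" "x2 \<cdot> g' = k'"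
    using pullback_lift[OF 2(3,1,2) comp_in_hom[OF 0(1) t(2)] 0(2)] by blast
  show thesis
    using that[OF 0(1) 1(1,2) 2(1,2) f'(1) g'(1) _ pullback_commutes[OF 1(3)] pullback_commutes[OF 2(3)] f'(2) g'(2)]
      pushout_stable[OF po t b f'(1) g'(1) 1(2) 2(2) 1(3) 2(3) 0(3) f'(2) g'(2) f'(3) g'(3)] by blast
qed

end

context classified_quasitopos
begin

lemma DPO_modeled_by_PBPO_plus: "DPO C (regular_monos C) \<prec> PBPO_plus C (regular_monos C)"
  unfolding modeled_by_def
proof
  fix \<rho> assume "\<rho> \<in> rules (DPO C (regular_monos C))"
  then obtain l r K L R where \<rho>: "\<rho> = Span_Rule l r" and
    t: "l \<in> hom C K L" "r \<in> hom C K R" and l: "l \<in> regular_monos C"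
    by (cases \<rho>) (auto simp: DPO_def)
  have ob: "K \<in> Ob C" "L \<in> Ob C" using t hom_objs by blast+
  note \<eta> = unit_hom[OF ob(1)] and idK = ident_in_hom[OF ob(1)] and idL = ident_in_hom[OF ob(2)]
  obtain L' t\<^sub>L l' where t': "t\<^sub>L \<in> hom C L L'" "l' \<in> hom C (T K) L'" and po: "is_pushout C l (\<eta> K) t\<^sub>L l'"
    using pushout_exists[OF t(1) \<eta>] .
  have c: "t\<^sub>L \<cdot> l = l' \<cdot> \<eta> K" using pushout_commutes[OF po] .
  note pb = pushout_regular_mono_pullback[OF po l t(1) \<eta> t']
  note l'_eqI = pushout_regular_mono_eqI[OF po l t(1) \<eta> t']
  \<comment> \<open>With the legs exchanged, \<open>\<eta> K\<close> is the regular mono, so the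
    coprojection from \<open>L\<close> is monic as well.\<close>
  note t\<^sub>L_eqI = pushout_regular_mono_eqI[OF pushout_sym[OF po] unit_regular_mono[OF ob(1)] \<eta> t(1) t'(2,1)]
  define \<tau> where "\<tau> = PBPO_Plus_Rule l r t\<^sub>L (\<eta> K) l'"
  note step_iff = pbpo_plus_step_iff[OF t(1) t'(1) \<eta> t'(2) c, of r, folded \<tau>_def]
  have \<tau>: "\<tau> \<in> rules (PBPO_plus C (regular_monos C))"
    unfolding \<tau>_def PBPO_plus_def using t \<eta> t' pb by auto
  have eqs: "Dom C l = K" "Cod C l = L" using t by (simp_all add: hom_def)
  have "\<exists>\<alpha>. pbpo_plus_step C \<tau> m \<alpha> G H" if m: "m \<in> regular_monos C" and step: "dpo_step C \<rho> m G H" for m G H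
  proof -
    from step obtain G\<^sub>K u g\<^sub>L g\<^sub>R w where
      s: "u \<in> hom C K G\<^sub>K" "g\<^sub>L \<in> hom C G\<^sub>K G" "m \<in> hom C L G" "g\<^sub>R \<in> hom C G\<^sub>K H" and
      pol: "is_pushout C u l g\<^sub>L m" and por: "is_pushout C u r g\<^sub>R w"
      unfolding \<rho> dpo_step.simps eqs by blast
    note po2 = pushout_sym[OF pol]
    note pb2 = pushout_regular_mono_pullback[OF po2 l t(1) s(1,3,2)]
    note g\<^sub>L_eqI = pushout_regular_mono_eqI[OF po2 l t(1) s(1,3,2)]
    have sq: "g\<^sub>L \<cdot> u = m \<cdot> l" using pushout_commutes[OF pol] .
    \<comment> \<open>The pushout square is also a pullback, so \<open>u\<close> inherits regularity
      from the match and \<open>[u, 1]\<close> exists.\<close>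
    have u: "u \<in> regular_monos C" using regular_mono_pullback[OF pullback_sym[OF pb2] m] .
    obtain v where v: "v \<in> hom C G\<^sub>K (T K)" and pv: "is_pullback C v (\<eta> K) u (Ident C K)"
      using classify[OF u s(1) idK] by blast
    have vu: "v \<cdot> u = \<eta> K" using pullback_commutes[OF pv] comp_ident_right[OF \<eta>] by simp
    have "(l' \<cdot> v) \<cdot> u = t\<^sub>L \<cdot> l" using comp_assoc[OF s(1) v t'(2)] vu c by simp
    then obtain \<alpha> where \<alpha>: "\<alpha> \<in> hom C G L'" "\<alpha> \<cdot> g\<^sub>L = l' \<cdot> v" "\<alpha> \<cdot> m = t\<^sub>L"
      using pushout_desc[OF pol s(2,3) comp_in_hom[OF v t'(2)] t'(1)] by blast
    have "is_pullback C t\<^sub>L \<alpha> (Ident C L) m"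
    proof (rule pullbackI[OF t'(1) \<alpha>(1) idL s(3)])
      show "t\<^sub>L \<cdot> Ident C L = \<alpha> \<cdot> m" using \<alpha> comp_ident_right[OF t'(1)] by simp
    next
      fix Z a b assume ab: "a \<in> hom C Z L" "b \<in> hom C Z G" "t\<^sub>L \<cdot> a = \<alpha> \<cdot> b"
      obtain Z0 Z1 Z2 k0 a1 x1 a2 x2 f' g'
        where "k0 \<in> hom C Z0 K" and z: "a1 \<in> hom C Z1 L" "x1 \<in> hom C Z1 Z" "a2 \<in> hom C Z2 G\<^sub>K" "x2 \<in> hom C Z2 Z"
        and "f' \<in> hom C Z0 Z1" "g' \<in> hom C Z0 Z2" and poz: "is_pushout C f' g' x1 x2"
        and e1: "m \<cdot> a1 = b \<cdot> x1" and e2: "g\<^sub>L \<cdot> a2 = b \<cdot> x2" and "a1 \<cdot> f' = l \<cdot> k0" "a2 \<cdot> g' = u \<cdot> k0"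
        by (rule pushout_pullback_cover[OF po2 t(1) s(1,3,2) ab(2)])
      \<comment> \<open>Over \<open>L\<close>, \<open>a\<close> equals \<open>a1\<close> because
        \<open>t\<^sub>L\<close> is monic. Over \<open>G\<^sub>K\<close>, the type pullback puts
        \<open>a\<close> into the image of \<open>l\<close> through some \<open>k\<close>, and the
        square of \<open>v\<close> gives \<open>a2 = u \<cdot> k\<close>. So
        \<open>b = m \<cdot> a\<close> on both parts.\<close>
      have "t\<^sub>L \<cdot> (a \<cdot> x1) = t\<^sub>L \<cdot> a1"
        using ab z \<alpha> s t' by (simp add: hom_def comp_extend[OF ab(3)] e1[symmetric] comp_extend[OF \<alpha>(3)] comp_assoc_arr)
      then have ax1: "a \<cdot> x1 = a1" using t\<^sub>L_eqI[OF comp_in_hom[OF z(2) ab(1)] z(1)] by blast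
      have "t\<^sub>L \<cdot> (a \<cdot> x2) = l' \<cdot> (v \<cdot> a2)"
        using ab z \<alpha> s t' v by (simp add: hom_def comp_extend[OF ab(3)] e2[symmetric] comp_extend[OF \<alpha>(2)] comp_assoc_arr)
      then obtain k where k: "k \<in> hom C Z2 K" "l \<cdot> k = a \<cdot> x2" "\<eta> K \<cdot> k = v \<cdot> a2"
        using pullback_lift[OF pb t(1) \<eta> comp_in_hom[OF z(4) ab(1)] comp_in_hom[OF z(3) v]] by blast
      obtain k' where "k' \<in> hom C Z2 K" "u \<cdot> k' = a2" "Ident C K \<cdot> k' = k"
        using pullback_lift[OF pv s(1) idK z(3) k(1) k(3)[symmetric]] .
      then have uk: "u \<cdot> k = a2" by (simp add: comp_ident_left)
      have "b = m \<cdot> a"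
      proof (rule pushout_eqI[OF poz z(2) ab(2) comp_in_hom[OF ab(1) s(3)]])
        show "b \<cdot> x1 = (m \<cdot> a) \<cdot> x1"
          using comp_assoc[OF z(2) ab(1) s(3)] ax1 e1 by simp
        show "b \<cdot> x2 = (m \<cdot> a) \<cdot> x2"
          using comp_assoc[OF z(4) ab(1) s(3)] k(2)[symmetric] uk e2 comp_commute[OF sq s(1,2) t(1) s(3) k(1)] by simp
      qed
      then show "\<exists>h\<in>hom C Z L. Ident C L \<cdot> h = a \<and> m \<cdot> h = b" using ab(1) comp_ident_left by blast
    qed (simp add: comp_ident_left)
    moreover have "is_pullback C \<alpha> l' g\<^sub>L v"
    proof (rule pullbackI[OF \<alpha>(1) t'(2) s(2) v \<alpha>(2)])
      fix Z b a assume ab: "b \<in> hom C Z G" "a \<in> hom C Z (T K)" "\<alpha> \<cdot> b = l' \<cdot> a"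
      obtain Z0 Z1 Z2 k0 a1 x1 a2 x2 f' g'
        where k0: "k0 \<in> hom C Z0 K"
        and z: "a1 \<in> hom C Z1 L" "x1 \<in> hom C Z1 Z" "a2 \<in> hom C Z2 G\<^sub>K" "x2 \<in> hom C Z2 Z"
        and f': "f' \<in> hom C Z0 Z1" and "g' \<in> hom C Z0 Z2" and poz: "is_pushout C f' g' x1 x2"
        and e1: "m \<cdot> a1 = b \<cdot> x1" and e2: "g\<^sub>L \<cdot> a2 = b \<cdot> x2"
        and e3: "a1 \<cdot> f' = l \<cdot> k0" and e4: "a2 \<cdot> g' = u \<cdot> k0"
        by (rule pushout_pullback_cover[OF po2 t(1) s(1,3,2) ab(1)])
      have "t\<^sub>L \<cdot> a1 = l' \<cdot> (a \<cdot> x1)"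
        using ab(1,2) z \<alpha> s t' by (simp add: hom_def comp_extend[OF ab(3)[symmetric]] e1[symmetric] comp_extend[OF \<alpha>(3)] comp_assoc_arr)
      then obtain k where k: "k \<in> hom C Z1 K" "l \<cdot> k = a1" "\<eta> K \<cdot> k = a \<cdot> x1"
        using pullback_lift[OF pb t(1) \<eta> z(1) comp_in_hom[OF z(2) ab(2)]] by blast
      \<comment> \<open>Over \<open>L\<close> the lift to \<open>G\<^sub>K\<close> must be
        \<open>u \<cdot> k\<close>, over \<open>G\<^sub>K\<close> it is \<open>a2\<close>. This
        equation makes the two agree on the overlap, so they glue to \<open>h\<close>.\<close>
      have "k \<cdot> f' = k0"
        by (rule regular_mono_eqI[OF l t(1) comp_in_hom[OF f' k(1)] k0])
          (use comp_assoc[OF f' k(1) t(1)] k(2) e3 in simp)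
      then have "(u \<cdot> k) \<cdot> f' = a2 \<cdot> g'" using comp_assoc[OF f' k(1) s(1)] e4 by simp
      then obtain h where h: "h \<in> hom C Z G\<^sub>K" "h \<cdot> x1 = u \<cdot> k" "h \<cdot> x2 = a2"
        using pushout_desc[OF poz z(2,4) comp_in_hom[OF k(1) s(1)] z(3)] by blast
      have "g\<^sub>L \<cdot> h = b"
      proof (rule pushout_eqI[OF poz z(2) comp_in_hom[OF h(1) s(2)] ab(1)])
        show "(g\<^sub>L \<cdot> h) \<cdot> x1 = b \<cdot> x1"
          using comp_assoc[OF z(2) h(1) s(2)] h(2) comp_commute[OF sq s(1,2) t(1) s(3) k(1)] k(2) e1 by simp
        show "(g\<^sub>L \<cdot> h) \<cdot> x2 = b \<cdot> x2"
          using comp_assoc[OF z(4) h(1) s(2)] h(3) e2 by simp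
      qed
      moreover have "v \<cdot> h = a"
      proof (rule pushout_eqI[OF poz z(2) comp_in_hom[OF h(1) v] ab(2)])
        show "(v \<cdot> h) \<cdot> x1 = a \<cdot> x1"
          using comp_assoc[OF z(2) h(1) v] comp_assoc[OF k(1) s(1) v] h(2) vu k(3) by simp
        have "l' \<cdot> (v \<cdot> a2) = l' \<cdot> (a \<cdot> x2)"
          using ab(1,2) z \<alpha> s t' v
          by (simp add: hom_def comp_extend[OF ab(3)[symmetric]] e2[symmetric] comp_extend[OF \<alpha>(2)] comp_assoc_arr)
        then have "v \<cdot> a2 = a \<cdot> x2"
          using l'_eqI[OF comp_in_hom[OF z(3) v] comp_in_hom[OF z(4) ab(2)]] by blast
        then show "(v \<cdot> h) \<cdot> x2 = a \<cdot> x2" using comp_assoc[OF z(4) h(1) v] h(3) by simp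
      qed
      ultimately show "\<exists>h\<in>hom C Z G\<^sub>K. g\<^sub>L \<cdot> h = b \<and> v \<cdot> h = a" using h(1) by blast
    qed (rule g\<^sub>L_eqI)
    ultimately show ?thesis unfolding step_iff using s \<alpha> sq vu por by blast
  qed
  moreover have "dpo_step C \<rho> m G H" if step: "pbpo_plus_step C \<tau> m \<alpha> G H" for m \<alpha> G H
  proof -
    from step obtain G\<^sub>K u g\<^sub>L u' g\<^sub>R w where
      s: "m \<in> hom C L G" "\<alpha> \<in> hom C G L'" "u \<in> hom C K G\<^sub>K" "g\<^sub>L \<in> hom C G\<^sub>K G" "g\<^sub>R \<in> hom C G\<^sub>K H" and
      pm: "is_pullback C t\<^sub>L \<alpha> (Ident C L) m" and pb': "is_pullback C \<alpha> l' g\<^sub>L u'" and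
      sq: "g\<^sub>L \<cdot> u = m \<cdot> l" "u' \<cdot> u = \<eta> K" and por: "is_pushout C u r g\<^sub>R w"
      unfolding step_iff by blast
    \<comment> \<open>Along \<open>\<alpha>\<close> the corners of the type pushout pull back as
      follows: \<open>L\<close> to \<open>L\<close> by the match condition, \<open>T K\<close> to
      \<open>G\<^sub>K\<close>, and \<open>K\<close> to \<open>K\<close> by pasting.\<close>
    have "is_pullback C (t\<^sub>L \<cdot> l) \<alpha> (Ident C K) (m \<cdot> l)"
      using pullback_paste[OF pm pullback_sym[OF pullback_ident[OF t(1)]]] .
    from pushout_stable[OF po t(1) \<eta> t' s(2) t(1) s(3,1,4) pm pullback_sym[OF pb'] this]
    have "is_pushout C l u m g\<^sub>L"
      using comp_ident_left[OF t(1)] comp_ident_right[OF t(1)] comp_ident_right[OF \<eta>] sq by simp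
    from pushout_sym[OF this] show ?thesis unfolding \<rho> dpo_step.simps eqs using s por by blast
  qed
  ultimately have "rewrites_to (DPO C (regular_monos C)) \<rho> = rewrites_to (PBPO_plus C (regular_monos C)) \<tau>"
    by (intro ext, simp add: DPO_def PBPO_plus_def, blast)
  with \<tau> show "\<exists>\<tau>\<in>rules (PBPO_plus C (regular_monos C)).
      rewrites_to (DPO C (regular_monos C)) \<rho> = rewrites_to (PBPO_plus C (regular_monos C)) \<tau>" by blast
qed

text \<open>Besides \<open>L'\<close>, the rule changes in \<open>K\<close>, which becomes the pullback that a PBPO\<open>\<^sup>+\<close> rule demands,
  and in \<open>R\<close>, which is pushed out along \<open>K \<rightarrow> K0\<close>; composing pushouts yields the same steps.\<close>

lemma PBPO_modeled_by_PBPO_plus: "PBPO C (regular_monos C) \<prec> PBPO_plus C (regular_monos C)"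
  unfolding modeled_by_def
proof
  fix \<rho> assume "\<rho> \<in> rules (PBPO C (regular_monos C))"
  then obtain l r t\<^sub>L t\<^sub>K t\<^sub>R l' r' K L R K' L' where \<rho>: "\<rho> = PBPO_Rule l r t\<^sub>L t\<^sub>K t\<^sub>R l' r'" and
    t: "l \<in> hom C K L" "r \<in> hom C K R" "t\<^sub>L \<in> hom C L L'" "t\<^sub>K \<in> hom C K K'" "l' \<in> hom C K' L'" and
    c: "t\<^sub>L \<cdot> l = l' \<cdot> t\<^sub>K"
    by (cases \<rho>) (auto simp: PBPO_def)
  have ob: "L \<in> Ob C" "L' \<in> Ob C" using t hom_objs by blast+
  note \<eta> = unit_hom[OF ob(1)] and idL = ident_in_hom[OF ob(1)]
  obtain P \<pi> \<sigma> where prod: "is_product C L' (T L) P \<pi> \<sigma>"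
    using product_exists[OF ob(2) hom_objs(2)[OF \<eta>]] .
  then have \<pi>: "\<pi> \<in> hom C P L'" and \<sigma>: "\<sigma> \<in> hom C P (T L)" and
    pair: "\<And>Z a b. a \<in> hom C Z L' \<Longrightarrow> b \<in> hom C Z (T L) \<Longrightarrow> \<exists>!h. h \<in> hom C Z P \<and> \<pi> \<cdot> h = a \<and> \<sigma> \<cdot> h = b"
    unfolding is_product_def by auto
  obtain \<theta> where \<theta>: "\<theta> \<in> hom C L P" "\<pi> \<cdot> \<theta> = t\<^sub>L" "\<sigma> \<cdot> \<theta> = \<eta> L" using pair[OF t(3) \<eta>] by blast
  obtain K2 l2 \<kappa> where l2: "l2 \<in> hom C K2 P" "\<kappa> \<in> hom C K2 K'" "is_pullback C \<pi> l' l2 \<kappa>"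
    using pullback_exists[OF \<pi> t(5)] .
  obtain K0 l0 t0 where l0: "l0 \<in> hom C K0 L" "t0 \<in> hom C K0 K2" "is_pullback C \<theta> l2 l0 t0"
    using pullback_exists[OF \<theta>(1) l2(1)] .
  have t0: "\<kappa> \<cdot> t0 \<in> hom C K0 K'" using l0 l2 comp_in_hom by blast
  have pb0: "is_pullback C t\<^sub>L l' l0 (\<kappa> \<cdot> t0)" using pullback_paste[OF l2(3) l0(3)] \<theta>(2) by simp
  \<comment> \<open>\<open>j\<close> measures how far the square of the given rule is from being a
    pullback.\<close>
  obtain j where j: "j \<in> hom C K K0" "l0 \<cdot> j = l" "(\<kappa> \<cdot> t0) \<cdot> j = t\<^sub>K"
    using pullback_lift[OF pb0 l0(1) t0 t(1,4) c] .
  obtain R0 r0 \<rho>0 where r0: "r0 \<in> hom C K0 R0" "\<rho>0 \<in> hom C R R0" "is_pushout C j r r0 \<rho>0"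
    using pushout_exists[OF j(1) t(2)] .
  define \<tau> where "\<tau> = PBPO_Plus_Rule l0 r0 \<theta> t0 l2"
  note step_iff = pbpo_plus_step_iff[OF l0(1) \<theta>(1) l0(2) l2(1) pullback_commutes[OF l0(3)], of r0, folded \<tau>_def]
  have \<tau>: "\<tau> \<in> rules (PBPO_plus C (regular_monos C))"
    unfolding \<tau>_def PBPO_plus_def using l0 r0 \<theta> l2 by auto
  have eqs: "Dom C l = K" "Cod C l = L" "Cod C t\<^sub>L = L'" using t by (simp_all add: hom_def)
  have "\<exists>\<alpha>. pbpo_plus_step C \<tau> m \<alpha> G H" if m: "m \<in> regular_monos C" and step: "pbpo_step C \<rho> m \<alpha> G H" for m \<alpha> G H
  proof -
    from step obtain G\<^sub>K u g\<^sub>L u' g\<^sub>R w where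
      s: "m \<in> hom C L G" "\<alpha> \<in> hom C G L'" "u \<in> hom C K G\<^sub>K" "g\<^sub>L \<in> hom C G\<^sub>K G" "g\<^sub>R \<in> hom C G\<^sub>K H" and
      \<alpha>m: "\<alpha> \<cdot> m = t\<^sub>L" and pb: "is_pullback C \<alpha> l' g\<^sub>L u'" and
      sq: "g\<^sub>L \<cdot> u = m \<cdot> l" "u' \<cdot> u = t\<^sub>K" and po: "is_pushout C u r g\<^sub>R w"
      unfolding \<rho> pbpo_step.simps eqs by blast
    have u': "u' \<in> hom C G\<^sub>K K'" using pullback_homs(2)[OF pullback_sym[OF pb] t(5) s(4)] .
    define \<mu> where "\<mu> = cls m (Ident C L)"
    note \<mu> = classify[OF m s(1) idL, folded \<mu>_def]
    have \<mu>m: "\<mu> \<cdot> m = \<eta> L" using pullback_commutes[OF \<mu>(2)] comp_ident_right[OF \<eta>] by simp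
    obtain \<beta> where \<beta>: "\<beta> \<in> hom C G P" "\<pi> \<cdot> \<beta> = \<alpha>" "\<sigma> \<cdot> \<beta> = \<mu>" using pair[OF s(2) \<mu>(1)] by blast
    have \<beta>m: "\<beta> \<cdot> m = \<theta>"
    proof -
      have "\<beta> \<cdot> m \<in> hom C L P" "\<pi> \<cdot> (\<beta> \<cdot> m) = t\<^sub>L" "\<sigma> \<cdot> (\<beta> \<cdot> m) = \<eta> L"
        using comp_in_hom[OF s(1) \<beta>(1)] comp_assoc[OF s(1) \<beta>(1) \<pi>] comp_assoc[OF s(1) \<beta>(1) \<sigma>] \<beta> \<alpha>m \<mu>m by simp_all
      then show ?thesis using \<theta> pair[OF t(3) \<eta>] by blast
    qed
    have pm: "is_pullback C \<theta> \<beta> (Ident C L) m"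
    proof (rule pullbackI[OF \<theta>(1) \<beta>(1) idL s(1)])
      show "\<theta> \<cdot> Ident C L = \<beta> \<cdot> m" using \<beta>m comp_ident_right[OF \<theta>(1)] by simp
    next
      fix Z a b assume ab: "a \<in> hom C Z L" "b \<in> hom C Z G" "\<theta> \<cdot> a = \<beta> \<cdot> b"
      \<comment> \<open>The component in \<open>T L\<close> alone gives
        \<open>b = m \<cdot> a\<close>, whatever \<open>\<alpha>\<close> identifies outside the
        match.\<close>
      have "\<mu> \<cdot> b = \<eta> L \<cdot> a"
        using comp_assoc[OF ab(1) \<theta>(1) \<sigma>] comp_assoc[OF ab(2) \<beta>(1) \<sigma>] ab(3) \<beta>(3) \<theta>(3) by simp
      then obtain k where "k \<in> hom C Z L" "m \<cdot> k = b" "Ident C L \<cdot> k = a"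
        using pullback_lift[OF \<mu>(2) s(1) idL ab(2,1)] by blast
      then show "\<exists>h\<in>hom C Z L. Ident C L \<cdot> h = a \<and> m \<cdot> h = b" by blast
    qed (simp add: comp_ident_left)
    \<comment> \<open>Since \<open>l2\<close> is the pullback of \<open>l'\<close> along
      \<open>\<pi>\<close>, pulling \<open>l2\<close> back along \<open>\<beta>\<close> gives the
      same \<open>G\<^sub>K\<close> as pulling \<open>l'\<close> back along
      \<open>\<alpha>\<close>.\<close>
    have "\<pi> \<cdot> (\<beta> \<cdot> g\<^sub>L) = l' \<cdot> u'"
      using comp_assoc[OF s(4) \<beta>(1) \<pi>] \<beta>(2) pullback_commutes[OF pb] by simp
    then obtain u2 where u2: "u2 \<in> hom C G\<^sub>K K2" "l2 \<cdot> u2 = \<beta> \<cdot> g\<^sub>L" "\<kappa> \<cdot> u2 = u'"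
      using pullback_lift[OF l2(3,1,2) comp_in_hom[OF s(4) \<beta>(1)] u'] by blast
    have pb2: "is_pullback C \<beta> l2 g\<^sub>L u2"
      using pullback_cancel[OF l2(3) _ \<beta>(1) \<pi> u2(1) l2(2) u2(2)[symmetric]] pb \<beta>(2) u2(3) by simp
    have "\<alpha> \<cdot> (m \<cdot> l0) = l' \<cdot> (\<kappa> \<cdot> t0)"
      using comp_assoc[OF l0(1) s(1,2)] \<alpha>m pullback_commutes[OF pb0] by simp
    then obtain u0 where u0: "u0 \<in> hom C K0 G\<^sub>K" "g\<^sub>L \<cdot> u0 = m \<cdot> l0" "u' \<cdot> u0 = \<kappa> \<cdot> t0"
      using pullback_lift[OF pb s(4) u' comp_in_hom[OF l0(1) s(1)] t0] by blast
    have "u2 \<cdot> u0 = t0"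
    proof (rule pullback_eqI[OF l2(3,1) comp_in_hom[OF u0(1) u2(1)] l0(2)])
      show "l2 \<cdot> (u2 \<cdot> u0) = l2 \<cdot> t0"
        using u0 u2 l2 l0 s \<beta> \<theta> pullback_commutes[OF l0(3)]
        by (simp add: hom_def comp_extend[OF u2(2)] comp_assoc_arr comp_extend[OF \<beta>m])
      show "\<kappa> \<cdot> (u2 \<cdot> u0) = \<kappa> \<cdot> t0"
        using comp_assoc[OF u0(1) u2(1) l2(2)] u2(3) u0(3) by simp
    qed
    have u0j: "u0 \<cdot> j = u"
    proof (rule pullback_eqI[OF pb s(4) comp_in_hom[OF j(1) u0(1)] s(3)])
      show "g\<^sub>L \<cdot> (u0 \<cdot> j) = g\<^sub>L \<cdot> u"
        using comp_assoc[OF j(1) u0(1) s(4)] comp_assoc[OF j(1) l0(1) s(1)] u0(2) j(2) sq by simp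
      show "u' \<cdot> (u0 \<cdot> j) = u' \<cdot> u"
        using comp_assoc[OF j(1) u0(1) u'] u0(3) j(3) sq by simp
    qed
    have w: "w \<in> hom C R H" using pushout_typing[OF po] s(5) t(2) hom_unique by metis
    have "(g\<^sub>R \<cdot> u0) \<cdot> j = w \<cdot> r"
      using comp_assoc[OF j(1) u0(1) s(5)] u0j pushout_commutes[OF po] by simp
    then obtain w0 where w0: "w0 \<in> hom C R0 H" "w0 \<cdot> r0 = g\<^sub>R \<cdot> u0" "w0 \<cdot> \<rho>0 = w"
      using pushout_desc[OF r0(3,1,2) comp_in_hom[OF u0(1) s(5)] w] by blast
    \<comment> \<open>Pushing \<open>r\<close> out along \<open>u = u0 \<cdot> j\<close> splits into
      a pushout along \<open>j\<close>, which yields \<open>r0\<close>, and one along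
      \<open>u0\<close>; cancelling the former leaves the latter.\<close>
    have "is_pushout C u0 r0 g\<^sub>R w0"
      using pushout_cancel[OF r0(3) _ u0(1) j(1) w0(1) r0(2) w0(2)[symmetric]] po u0j w0(3) by simp
    then show ?thesis
      unfolding step_iff using s(1,4,5) \<beta>(1) \<beta>m pm u0(1,2) pb2 \<open>u2 \<cdot> u0 = t0\<close> by blast
  qed
  moreover have "\<exists>\<alpha>. pbpo_step C \<rho> m \<alpha> G H" if step: "pbpo_plus_step C \<tau> m \<beta> G H" for m \<beta> G H
  proof -
    from step obtain G\<^sub>K u0 g\<^sub>L u2 g\<^sub>R w0 where
      s: "m \<in> hom C L G" "\<beta> \<in> hom C G P" "u0 \<in> hom C K0 G\<^sub>K" "g\<^sub>L \<in> hom C G\<^sub>K G" "g\<^sub>R \<in> hom C G\<^sub>K H" and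
      \<beta>m: "\<beta> \<cdot> m = \<theta>" and pb: "is_pullback C \<beta> l2 g\<^sub>L u2" and
      sq: "g\<^sub>L \<cdot> u0 = m \<cdot> l0" "u2 \<cdot> u0 = t0" and po: "is_pushout C u0 r0 g\<^sub>R w0"
      unfolding step_iff by blast
    have u2: "u2 \<in> hom C G\<^sub>K K2" using pullback_homs(2)[OF pullback_sym[OF pb] l2(1) s(4)] .
    \<comment> \<open>Forgetting the component in \<open>T L\<close> recovers a PBPO
      adherence.\<close>
    have "(\<pi> \<cdot> \<beta>) \<cdot> m = t\<^sub>L" using comp_assoc[OF s(1,2) \<pi>] \<beta>m \<theta>(2) by simp
    moreover have "is_pullback C (\<pi> \<cdot> \<beta>) l' g\<^sub>L (\<kappa> \<cdot> u2)" using pullback_paste[OF l2(3) pb] .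
    moreover have "g\<^sub>L \<cdot> (u0 \<cdot> j) = m \<cdot> l"
      using comp_assoc[OF j(1) s(3,4)] comp_assoc[OF j(1) l0(1) s(1)] sq(1) j(2) by simp
    moreover have "(\<kappa> \<cdot> u2) \<cdot> (u0 \<cdot> j) = t\<^sub>K"
      using j s u2 l2 l0 by (simp add: hom_def comp_arr comp_assoc_arr comp_extend[OF sq(2)])
    moreover have "is_pushout C (u0 \<cdot> j) r g\<^sub>R (w0 \<cdot> \<rho>0)" using pushout_paste[OF r0(3) po] .
    moreover have "\<pi> \<cdot> \<beta> \<in> hom C G L'" "u0 \<cdot> j \<in> hom C K G\<^sub>K" using comp_in_hom s \<pi> j by blast+
    ultimately show ?thesis unfolding \<rho> pbpo_step.simps eqs using s by blast
  qed
  ultimately have "rewrites_to (PBPO C (regular_monos C)) \<rho> = rewrites_to (PBPO_plus C (regular_monos C)) \<tau>"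
    by (intro ext, simp add: PBPO_def PBPO_plus_def, blast)
  with \<tau> show "\<exists>\<tau>\<in>rules (PBPO_plus C (regular_monos C)).
      rewrites_to (PBPO C (regular_monos C)) \<rho> = rewrites_to (PBPO_plus C (regular_monos C)) \<tau>" by blast
qed

end

text \<open>Existence of a classifier keeps the claims about AGREE from being vacuous. DPO, PBPO and
  PBPO+ do not mention one, so any classifier may serve to build their target rules.\<close>

theorem theorem4:
  fixes C :: "('o, 'a) cat"
  assumes "quasitopos C"
  shows "(\<exists>T Tm \<eta>. is_partial_map_classifier C (regular_monos C) T Tm \<eta>) \<and>
    (\<forall>T Tm \<eta>. is_partial_map_classifier C (regular_monos C) T Tm \<eta> \<longrightarrow>
       SqPO C (regular_monos C) \<prec> AGREE C (regular_monos C) T \<eta> \<and>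
       AGREE C (regular_monos C) T \<eta> \<prec> PBPO_plus C (regular_monos C)) \<and>
    DPO C (regular_monos C) \<prec> PBPO_plus C (regular_monos C) \<and>
    PBPO C (regular_monos C) \<prec> PBPO_plus C (regular_monos C)"
proof -
  have loc: "classified_quasitopos C T Tm \<eta>" if "is_partial_map_classifier C (regular_monos C) T Tm \<eta>" for T Tm \<eta>
    using assms that by (intro classified_quasitopos.intro classified_quasitopos_axioms.intro)
  obtain T Tm \<eta> where "is_partial_map_classifier C (regular_monos C) T Tm \<eta>"
    using quasitopos.partial_map_classifier_exists[OF assms] by blast
  then show ?thesis
    using loc classified_quasitopos.SqPO_modeled_by_AGREE classified_quasitopos.AGREE_modeled_by_PBPO_plus
      classified_quasitopos.DPO_modeled_by_PBPO_plus classified_quasitopos.PBPO_modeled_by_PBPO_plus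
    by blast
qed

end
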